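(* Let $\mathbb{D}$ be the open unit disk and let $T=\begin{pmatrix} T_0 & S_{0,1}\\ 0 & T_1\end{pmatrix}\in\mathcal{F}B_2(\mathbb{D})$ be a homogeneous operator. Then $$\operatorname{trace}\mathcal{K}_T=\mathcal{K}_{T_0}+\mathcal{K}_{T_1}\quad\text{on }\mathbb{D}.$$
   Context: For a connected open set $\Omega\subset\mathbb{C}$ and a complex separable Hilbert space $\mathcal H$, $B_n(\Omega)$ is the set of bounded operators $T$ on $\mathcal H$ with (1) $\Omega\subset\sigma(T)$; (2) $\dim\ker(T-w)=n$ for $w\in\Omega$; (3) $\bigvee_{w\in\Omega}\ker(T-w)=\mathcal H$ (closed linear span); (4) $\operatorname{ran}(T-w)=\mathcal H$ for $w\in\Omega$. For $T\in B_n(\Omega)$, $\mathcal{E}_T=\{(w,x)\in\Omega\times\mathcal H: x\in\ker(T-w)\}$ is a Hermitian holomorphic vector bundle of rank $n$ over $\Omega$. The curvature of a Hermitian holomorphic bundle with holomorphic frame $\{\gamma_1,\dots,\gamma_n\}$ and Gram matrix $h(w)=(\langle\gamma_j(w),\gamma_i(w)\rangle)_{i,j}$ is $\mathcal K(w)=-\frac{\partial}{\partial\overline w}\big(h^{-1}\frac{\partial h}{\partial w}\big)$; for a line bundle with non-vanishing holomorphic section $\gamma$ it is $-\frac{\partial^2}{\partial\overline w\partial w}\log\|\gamma(w)\|^2$. $\mathcal K_T$ denotes the curvature of $\mathcal{E}_T$. The class $\mathcal{F}B_2(\Omega)$ consists of the operators $T=\begin{pmatrix} T_0&S_{0,1}\\0&T_1\end{pmatrix}$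 on $\mathcal H_0\oplus\mathcal H_1$ with $T_0\in B_1(\Omega)$ on $\mathcal H_0$, $T_1\in B_1(\Omega)$ on $\mathcal H_1$, and $S_{0,1}:\mathcal H_1\to\mathcal H_0$ a non-zero bounded operator with $T_0S_{0,1}=S_{0,1}T_1$; such $T$ belong to $B_2(\Omega)$. A bounded operator $T$ is homogeneous if for every linear fractional transformation $\varphi$ of $\mathbb{D}$ onto $\mathbb{D}$ that is analytic on $\sigma(T)$, $\varphi(T)$ is unitarily equivalent to $T$. *)

theory Defs
  imports "HOL-Complex_Analysis.Complex_Analysis" "HOL-Library.Numeral_Type"
begin

section \<open>Complex Hilbert spaces\<close>

text \<open>
  The complex inner product is linear in the first argument; the library's real inner product is
  its real part, so the norm, the topology and completeness are those of \<^class>\<open>banach\<close>.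
  Separability is the sort \<^class>\<open>second_countable_topology\<close>, equivalent to it for metric spaces.
\<close>

class chilbert_space = real_inner + banach +
  fixes scaleC :: "complex \<Rightarrow> 'a \<Rightarrow> 'a"  (infixr "*\<^sub>C" 75)
    and cinner :: "'a \<Rightarrow> 'a \<Rightarrow> complex"
  assumes scaleC_add_right: "c *\<^sub>C (x + y) = c *\<^sub>C x + c *\<^sub>C y"
    and scaleC_add_left: "(c + d) *\<^sub>C x = c *\<^sub>C x + d *\<^sub>C x"
    and scaleC_scaleC: "c *\<^sub>C d *\<^sub>C x = (c * d) *\<^sub>C x"
    and scaleC_one: "1 *\<^sub>C x = x"
    and scaleR_scaleC: "r *\<^sub>R x = complex_of_real r *\<^sub>C x"
    and cinner_commute: "cinner x y = cnj (cinner y x)"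
    and cinner_add_left: "cinner (x + y) z = cinner x z + cinner y z"
    and cinner_scaleC_left: "cinner (c *\<^sub>C x) y = c * cinner x y"
    and inner_eq_Re_cinner: "x \<bullet> y = Re (cinner x y)"

global_interpretation complex_vector: vector_space "scaleC :: complex \<Rightarrow> 'a \<Rightarrow> 'a::chilbert_space"
  by standard (simp_all add: scaleC_add_right scaleC_add_left scaleC_scaleC scaleC_one)

text \<open>The product type with these operations is the orthogonal direct sum.\<close>

instantiation prod :: (chilbert_space, chilbert_space) chilbert_space
begin

definition scaleC_prod :: "complex \<Rightarrow> 'a \<times> 'b \<Rightarrow> 'a \<times> 'b" where
  "scaleC_prod c p = (c *\<^sub>C fst p, c *\<^sub>C snd p)"

definition cinner_prod :: "'a \<times> 'b \<Rightarrow> 'a \<times> 'b \<Rightarrow> complex" where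
  "cinner_prod p q = cinner (fst p) (fst q) + cinner (snd p) (snd q)"

instance
proof
  fix p q :: "'a \<times> 'b"
  show "cinner p q = cnj (cinner q p)"
    unfolding cinner_prod_def
    by (metis cinner_commute complex_cnj_add)
qed (auto simp: scaleC_prod_def cinner_prod_def scaleC_add_right scaleC_add_left scaleC_scaleC
      scaleC_one scaleR_scaleC cinner_add_left cinner_scaleC_left inner_eq_Re_cinner
      inner_prod_def scaleR_prod_def algebra_simps)

end


section \<open>Bounded operators\<close>

definition bounded_clinear :: "('a::chilbert_space \<Rightarrow> 'b::chilbert_space) \<Rightarrow> bool" where
  "bounded_clinear T \<longleftrightarrow> bounded_linear T \<and> (\<forall>c x. T (c *\<^sub>C x) = c *\<^sub>C T x)"

definition op_minus :: "('a::chilbert_space \<Rightarrow> 'a) \<Rightarrow> complex \<Rightarrow> 'a \<Rightarrow> 'a" where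
  "op_minus T w = (\<lambda>x. T x - w *\<^sub>C x)"

definition op_kernel :: "('a::chilbert_space \<Rightarrow> 'b::chilbert_space) \<Rightarrow> 'a set" where
  "op_kernel T = {x. T x = 0}"

definition spectrum :: "('a::chilbert_space \<Rightarrow> 'a) \<Rightarrow> complex set" where
  "spectrum T = {w. \<not> (\<exists>R. bounded_clinear R \<and> R \<circ> op_minus T w = id \<and> op_minus T w \<circ> R = id)}"

definition unitarily_equivalent ::
    "('a::chilbert_space \<Rightarrow> 'a) \<Rightarrow> ('b::chilbert_space \<Rightarrow> 'b) \<Rightarrow> bool" where
  "unitarily_equivalent A B \<longleftrightarrow>
     (\<exists>U. bounded_clinear U \<and> bij U \<and> (\<forall>x y. cinner (U x) (U y) = cinner x y) \<and> U \<circ> A = B \<circ> U)"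


section \<open>Homogeneous operators\<close>

definition linear_fractional :: "complex \<Rightarrow> complex \<Rightarrow> complex \<Rightarrow> complex \<Rightarrow> complex \<Rightarrow> complex" where
  "linear_fractional a b c d z = (a * z + b) / (c * z + d)"

text \<open>
  The value at \<open>T\<close> of the rational function above, that is, \<open>(a T + b) (c T + d)\<^sup>-\<^sup>1\<close>. It is only
  used when the pole lies outside the spectrum, and then \<open>c T + d\<close> is invertible.
\<close>

definition linear_fractional_op ::
    "complex \<Rightarrow> complex \<Rightarrow> complex \<Rightarrow> complex \<Rightarrow> ('a::chilbert_space \<Rightarrow> 'a) \<Rightarrow> 'a \<Rightarrow> 'a" where
  "linear_fractional_op a b c d T =
     (\<lambda>x. a *\<^sub>C T x + b *\<^sub>C x) \<circ> inv (\<lambda>x. c *\<^sub>C T x + d *\<^sub>C x)"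

text \<open>
  As \<open>z / 0 = 0\<close>, the function \<^const>\<open>linear_fractional\<close> is total but discontinuous at its pole;
  analyticity on the spectrum therefore says exactly that the pole is not in the spectrum.
\<close>

definition homogeneous :: "('a::chilbert_space \<Rightarrow> 'a) \<Rightarrow> bool" where
  "homogeneous T \<longleftrightarrow> bounded_clinear T \<and>
     (\<forall>a b c d. a * d - b * c \<noteq> 0 \<and>
        linear_fractional a b c d ` ball 0 1 = ball 0 1 \<and>
        linear_fractional a b c d analytic_on spectrum T \<longrightarrow>
        unitarily_equivalent (linear_fractional_op a b c d T) T)"


section \<open>The classes \<open>B\<^sub>n(\<Omega>)\<close> and \<open>FB\<^sub>2(\<Omega>)\<close>\<close>

text \<open>
  The library's \<open>dim\<close> is \<open>0\<close> for spaces without a finite basis; with \<open>n > 0\<close> the second condition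
  thus includes that the kernel is finite-dimensional.
\<close>

definition cowen_douglas ::
    "nat \<Rightarrow> complex set \<Rightarrow> ('a::{chilbert_space,second_countable_topology} \<Rightarrow> 'a) \<Rightarrow> bool" where
  "cowen_douglas n \<Omega> T \<longleftrightarrow>
     0 < n \<and> open \<Omega> \<and> connected \<Omega> \<and> bounded_clinear T \<and>
     \<Omega> \<subseteq> spectrum T \<and>
     (\<forall>w\<in>\<Omega>. complex_vector.dim (op_kernel (op_minus T w)) = n) \<and>
     closure (complex_vector.span (\<Union>w\<in>\<Omega>. op_kernel (op_minus T w))) = UNIV \<and>
     (\<forall>w\<in>\<Omega>. range (op_minus T w) = UNIV)"

definition block_op ::
    "('a::chilbert_space \<Rightarrow> 'a) \<Rightarrow> ('b::chilbert_space \<Rightarrow> 'a) \<Rightarrow> ('b \<Rightarrow> 'b) \<Rightarrow> 'a \<times> 'b \<Rightarrow> 'a \<times> 'b" where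
  "block_op T0 S T1 = (\<lambda>(x, y). (T0 x + S y, T1 y))"

text \<open>The operator \<^term>\<open>block_op T0 S T1\<close> belongs, with this decomposition, to \<open>FB\<^sub>2(\<Omega>)\<close>.\<close>

definition FB2 ::
    "complex set \<Rightarrow> ('a::{chilbert_space,second_countable_topology} \<Rightarrow> 'a) \<Rightarrow>
     ('b::{chilbert_space,second_countable_topology} \<Rightarrow> 'a) \<Rightarrow> ('b \<Rightarrow> 'b) \<Rightarrow> bool" where
  "FB2 \<Omega> T0 S T1 \<longleftrightarrow>
     cowen_douglas 1 \<Omega> T0 \<and> cowen_douglas 1 \<Omega> T1 \<and>
     bounded_clinear S \<and> S \<noteq> (\<lambda>y. 0) \<and> T0 \<circ> S = S \<circ> T1"


section \<open>Holomorphic frames and curvature\<close>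

text \<open>Norm-holomorphic vector-valued functions: \<open>v\<close> is the complex derivative.\<close>

definition vholomorphic_on :: "(complex \<Rightarrow> 'a::chilbert_space) \<Rightarrow> complex set \<Rightarrow> bool" where
  "vholomorphic_on \<gamma> U \<longleftrightarrow> (\<forall>w\<in>U. \<exists>v. (\<gamma> has_derivative (\<lambda>h. h *\<^sub>C v)) (at w within U))"

text \<open>
  A holomorphic section of the bundle \<open>E\<^sub>T\<close> is identified with its second component; the fibre
  over \<open>w\<close> is the kernel of \<open>T - w\<close>. The rank of a frame is the cardinality of its index type.
\<close>

definition holomorphic_frame ::
    "('a::chilbert_space \<Rightarrow> 'a) \<Rightarrow> complex set \<Rightarrow> ('n::finite \<Rightarrow> complex \<Rightarrow> 'a) \<Rightarrow> bool" where
  "holomorphic_frame T U \<gamma> \<longleftrightarrow>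
     (\<forall>i. vholomorphic_on (\<gamma> i) U) \<and>
     (\<forall>w\<in>U. inj (\<lambda>i. \<gamma> i w) \<and> complex_vector.independent (range (\<lambda>i. \<gamma> i w)) \<and>
        complex_vector.span (range (\<lambda>i. \<gamma> i w)) = op_kernel (op_minus T w))"

definition nonvanishing_section ::
    "('a::chilbert_space \<Rightarrow> 'a) \<Rightarrow> complex set \<Rightarrow> (complex \<Rightarrow> 'a) \<Rightarrow> bool" where
  "nonvanishing_section T U \<gamma> \<longleftrightarrow>
     vholomorphic_on \<gamma> U \<and> (\<forall>w\<in>U. \<gamma> w \<in> op_kernel (op_minus T w) \<and> \<gamma> w \<noteq> 0)"

text \<open>The Wirtinger derivatives with respect to \<open>w\<close> and its conjugate.\<close>

definition d_w :: "(complex \<Rightarrow> complex) \<Rightarrow> complex \<Rightarrow> complex" where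
  "d_w f w = (frechet_derivative f (at w) 1 - \<i> * frechet_derivative f (at w) \<i>) / 2"

definition d_wbar :: "(complex \<Rightarrow> complex) \<Rightarrow> complex \<Rightarrow> complex" where
  "d_wbar f w = (frechet_derivative f (at w) 1 + \<i> * frechet_derivative f (at w) \<i>) / 2"

definition gram_matrix ::
    "('n::finite \<Rightarrow> complex \<Rightarrow> 'a::chilbert_space) \<Rightarrow> complex \<Rightarrow> complex^'n^'n" where
  "gram_matrix \<gamma> w = (\<chi> i j. cinner (\<gamma> j w) (\<gamma> i w))"

definition frame_curvature ::
    "('n::finite \<Rightarrow> complex \<Rightarrow> 'a::chilbert_space) \<Rightarrow> complex \<Rightarrow> complex^'n^'n" where
  "frame_curvature \<gamma> w =
     (let h = gram_matrix \<gamma>;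
          dh = (\<lambda>z. \<chi> i j. d_w (\<lambda>u. h u $ i $ j) z);
          \<theta> = (\<lambda>z. matrix_inv (h z) ** dh z)
      in \<chi> i j. - d_wbar (\<lambda>z. \<theta> z $ i $ j) w)"

definition section_curvature :: "(complex \<Rightarrow> 'a::chilbert_space) \<Rightarrow> complex \<Rightarrow> complex" where
  "section_curvature \<gamma> w =
     - d_wbar (\<lambda>z. d_w (\<lambda>u. complex_of_real (ln ((norm (\<gamma> u))\<^sup>2))) z) w"

text \<open>
  The curvature of \<open>E\<^sub>T\<close> at \<open>w\<close>, computed in some holomorphic frame (non-vanishing section) over a
  neighbourhood of \<open>w\<close>; such frames exist for operators in \<open>B\<^sub>n(\<Omega>)\<close>. A change of frame
  conjugates the curvature matrix and leaves its trace, and the curvature of a line bundle,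
  unchanged.
\<close>

definition curvature ::
    "complex set \<Rightarrow> ('a::chilbert_space \<Rightarrow> 'a) \<Rightarrow> complex \<Rightarrow> complex^'n^('n::finite)" where
  "curvature \<Omega> T w =
     frame_curvature
       (SOME \<gamma> :: 'n \<Rightarrow> complex \<Rightarrow> 'a. \<exists>U. open U \<and> w \<in> U \<and> U \<subseteq> \<Omega> \<and> holomorphic_frame T U \<gamma>) w"

definition line_curvature :: "complex set \<Rightarrow> ('a::chilbert_space \<Rightarrow> 'a) \<Rightarrow> complex \<Rightarrow> complex" where
  "line_curvature \<Omega> T w =
     section_curvature
       (SOME \<gamma>. \<exists>U. open U \<and> w \<in> U \<and> U \<subseteq> \<Omega> \<and> nonvanishing_section T U \<gamma>) w"

end

theory Submission
  imports Defs
begin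

text \<open>
  If \<open>s0\<close> and \<open>s1\<close> are non-vanishing sections for \<open>T0\<close> and \<open>T1\<close>, then \<open>(s0, 0)\<close> and
  \<open>(- S s1', s1)\<close> form a holomorphic frame of \<open>E\<^sub>T\<close>. Its Gram determinant is
  \<open>(1 + q) \<parallel>s0\<parallel>\<^sup>2 \<parallel>s1\<parallel>\<^sup>2\<close>, where \<open>q w\<close> only depends on the position of the plane
  \<open>ker (T - w)\<close> relative to the two summands. Since the trace of the curvature is
  minus \<open>\<partial>\<partial>\<close>-bar of the logarithm of the Gram determinant, it suffices that \<open>q\<close> is locally
  constant. A unitary \<open>U\<close> with \<open>U \<phi>(T) = T U\<close> maps \<open>ker (T - w)\<close> onto \<open>ker (T - \<phi> w)\<close>, and it
  respects the decomposition of the space, because the diagonal blocks admit no non-zero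
  intertwiner that is also a commutator (Kleinecke-Shirokov). Hence \<open>q (\<phi> w) = q w\<close> for all disc
  automorphisms \<open>\<phi>\<close> close to the identity.
\<close>


section \<open>Bounded operators\<close>

text \<open>The obstacle is that \<open>U\<close> intertwines two different operators. Let
  \<open>X\<close> and \<open>Y\<close> be the lower entries of \<open>U\<close>, and let
  \<open>R1\<close> be the lower right entry of \<phi>(T), with off-diagonal entry
  \<open>S'\<close>. Then \<open>X S' = T1 Y - Y R1\<close>, which is no commutator because
  \<open>R1\<close> and \<open>T1\<close> differ. The lower left entry \<open>W\<close> of the
  inverse of \<open>U\<close> supplies an intertwiner \<open>V = W S\<close> from \<open>T1\<close>
  to \<open>R1\<close>, and \<open>X S' V = T1 (Y V) - (Y V) T1\<close> is a true commutator that
  commutes with \<open>T1\<close>. It acts on the eigenlines of \<open>T1\<close> by scalars, and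
  these must vanish. Intertwiners behave like holomorphic functions on a connected set: a product
  vanishes only if a factor does. So \<open>U\<close> or its inverse is triangular, and each of the
  two implies the other. A unitary that is triangular together with its inverse is block diagonal.

  The curvature is defined through some frame about which nothing else is known. The Gram
  determinant is therefore computed in an arbitrary holomorphic frame, where the transition
  determinant \<open>\<Delta>\<close> to the adapted frame adds the factor
  \<open>\<Delta> * cnj \<Delta>\<close>.\<close>

lemma cinner_zero_left [simp]: "cinner 0 y = 0"
  using cinner_add_left[of 0 0 y] by simp

lemma cinner_zero_right [simp]: "cinner x 0 = 0"
  by (metis cinner_commute cinner_zero_left complex_cnj_zero)

lemma cinner_add_right: "cinner x (y + z) = cinner x y + cinner x z"
  by (metis cinner_add_left cinner_commute complex_cnj_add)

lemma cinner_scaleC_right: "cinner x (c *\<^sub>C y) = cnj c * cinner x y"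
  by (metis cinner_commute cinner_scaleC_left complex_cnj_mult)

lemma cinner_self: "cinner x x = of_real ((norm x)\<^sup>2)"
proof -
  have "Im (cinner x x) = 0"
    using arg_cong[OF cinner_commute[of x x], of Im] by simp
  moreover have "Re (cinner x x) = (norm x)\<^sup>2"
    by (simp add: inner_eq_Re_cinner[symmetric] power2_norm_eq_inner)
  ultimately show ?thesis
    by (simp add: complex_eq_iff)
qed

lemma norm_scaleC: "norm (c *\<^sub>C x) = cmod c * norm x"
proof -
  have "complex_of_real ((norm (c *\<^sub>C x))\<^sup>2) = of_real ((cmod c * norm x)\<^sup>2)"
    unfolding cinner_self[symmetric] cinner_scaleC_left cinner_scaleC_right power_mult_distrib
    by (simp add: complex_norm_square cinner_self flip: of_real_power)
  then have "(norm (c *\<^sub>C x))\<^sup>2 = (cmod c * norm x)\<^sup>2"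
    using of_real_eq_iff by blast
  then show ?thesis
    by (simp add: power2_eq_iff_nonneg)
qed

lemma cmod_cinner_le: "cmod (cinner x y) \<le> norm x * norm y"
proof (cases "cinner x y = 0")
  case False
  \<comment> \<open>The phase that makes \<open>c * cinner x y\<close> real and non-negative, so
    that the real Cauchy-Schwarz inequality applies.\<close>
  define c where "c = cnj (cinner x y) / cmod (cinner x y)"
  have "cmod c = 1"
    using False by (simp add: c_def norm_divide)
  have "cmod (cinner x y) = Re (c * cinner x y)"
    using False cmod_power2[of "cinner x y"]
    by (simp add: c_def field_simps power2_eq_square)
  also have "\<dots> = (c *\<^sub>C x) \<bullet> y"
    by (simp add: inner_eq_Re_cinner cinner_scaleC_left)
  also have "\<dots> \<le> norm (c *\<^sub>C x) * norm y"
    by (rule norm_cauchy_schwarz)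
  finally show ?thesis
    by (simp add: norm_scaleC \<open>cmod c = 1\<close>)
qed simp

lemma bounded_bilinear_cinner: "bounded_bilinear cinner"
proof
  show "\<exists>K. \<forall>a b. norm (cinner a b) \<le> norm a * norm b * K"
    by (rule exI[of _ 1]) (simp add: cmod_cinner_le)
qed (simp_all add: cinner_add_left cinner_add_right scaleR_scaleC cinner_scaleC_left
    cinner_scaleC_right scaleR_conv_of_real)

lemma bounded_bilinear_scaleC: "bounded_bilinear (scaleC :: complex \<Rightarrow> 'a \<Rightarrow> 'a::chilbert_space)"
proof
  show "\<exists>K. \<forall>a b. norm (a *\<^sub>C (b::'a)) \<le> norm a * norm b * K"
    by (rule exI[of _ 1]) (simp add: norm_scaleC)
qed (simp_all add: scaleC_add_left scaleC_add_right scaleR_scaleC scaleC_scaleC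
    scaleR_conv_of_real mult.commute)

interpretation cinner: bounded_bilinear cinner
  by (rule bounded_bilinear_cinner)

interpretation scaleC: bounded_bilinear "scaleC :: complex \<Rightarrow> 'a \<Rightarrow> 'a::chilbert_space"
  by (rule bounded_bilinear_scaleC)

lemma cinner_self_eq_0_iff [simp]: "cinner x x = 0 \<longleftrightarrow> x = 0"
  by (simp add: cinner_self)

lemma cinner_all_zero: "(\<And>y. cinner x y = 0) \<Longrightarrow> x = 0"
  using cinner_self_eq_0_iff by blast

lemma bounded_clinear_linear: "bounded_clinear A \<Longrightarrow> bounded_linear A"
  by (simp add: bounded_clinear_def)

lemma bounded_clinear_scaleC: "bounded_clinear A \<Longrightarrow> A (c *\<^sub>C x) = c *\<^sub>C A x"
  by (simp add: bounded_clinear_def)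

lemmas bounded_clinear_zero = bounded_linear.linear[OF bounded_clinear_linear, THEN linear_0]
  and bounded_clinear_add = bounded_linear.linear[OF bounded_clinear_linear, THEN linear_add]
  and bounded_clinear_diff = bounded_linear.linear[OF bounded_clinear_linear, THEN linear_diff]
  and bounded_clinear_neg = bounded_linear.linear[OF bounded_clinear_linear, THEN linear_neg]

lemmas bounded_clinear_simps = bounded_clinear_zero bounded_clinear_add bounded_clinear_diff
  bounded_clinear_neg bounded_clinear_scaleC

lemma bounded_clinear_bound:
  assumes "bounded_clinear A" obtains K where "K > 0" "\<And>x. norm (A x) \<le> K * norm x"
  using bounded_linear.pos_bounded[OF bounded_clinear_linear[OF assms]] by (metis mult.commute)

lemma bounded_clinear_compose:
  "bounded_clinear A \<Longrightarrow> bounded_clinear B \<Longrightarrow> bounded_clinear (\<lambda>x. A (B x))"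
  by (simp add: bounded_clinear_def bounded_linear_compose)

lemma bounded_clinear_plus:
  "bounded_clinear A \<Longrightarrow> bounded_clinear B \<Longrightarrow> bounded_clinear (\<lambda>x. A x + B x)"
  by (simp add: bounded_clinear_def bounded_linear_add scaleC_add_right)

lemma bounded_clinear_cmult: "bounded_clinear A \<Longrightarrow> bounded_clinear (\<lambda>x. c *\<^sub>C A x)"
  by (auto simp: bounded_clinear_def scaleC_scaleC mult.commute
      intro: bounded_linear_compose[OF scaleC.bounded_linear_right])

lemma bounded_clinear_ident: "bounded_clinear (\<lambda>x. x)"
  by (simp add: bounded_clinear_def bounded_linear_ident)

lemma bounded_clinear_minus:
  "bounded_clinear A \<Longrightarrow> bounded_clinear B \<Longrightarrow> bounded_clinear (\<lambda>x. A x - B x)"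
  by (simp add: bounded_clinear_def bounded_linear_sub complex_vector.scale_right_diff_distrib)

lemma bounded_clinear_fst: "bounded_clinear fst"
  and bounded_clinear_snd: "bounded_clinear snd"
  by (simp_all add: bounded_clinear_def bounded_linear_fst bounded_linear_snd scaleC_prod_def)

lemma bounded_clinear_Pair:
  "bounded_clinear A \<Longrightarrow> bounded_clinear B \<Longrightarrow> bounded_clinear (\<lambda>x. (A x, B x))"
  by (simp add: bounded_clinear_def bounded_linear_Pair scaleC_prod_def)

lemma bounded_clinear_null: "bounded_clinear (\<lambda>x. 0)"
  by (simp add: bounded_clinear_def bounded_linear_zero)

lemmas bounded_clinear_intros = bounded_clinear_plus bounded_clinear_minus bounded_clinear_cmult
  bounded_clinear_ident bounded_clinear_Pair bounded_clinear_null

lemma bounded_clinear_op_minus: "bounded_clinear A \<Longrightarrow> bounded_clinear (op_minus A w)"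
  unfolding op_minus_def by (intro bounded_clinear_intros)

lemma bounded_clinear_has_derivative:
  assumes "bounded_clinear A" "(f has_derivative (\<lambda>h. h *\<^sub>C v)) F"
  shows "((\<lambda>z. A (f z)) has_derivative (\<lambda>h. h *\<^sub>C A v)) F"
  using bounded_linear.has_derivative[OF bounded_clinear_linear[OF assms(1)] assms(2)] assms(1)
  by (simp add: bounded_clinear_scaleC)

text \<open>Neumann series, by way of the contraction principle.\<close>

lemma bij_id_minus_contraction:
  fixes B :: "'a::chilbert_space \<Rightarrow> 'a"
  assumes B: "bounded_clinear B" and bound: "\<And>x. norm (B x) \<le> q * norm x" and "q < 1"
  shows "bij (\<lambda>x. x - B x)" and "bounded_clinear (inv (\<lambda>x. x - B x))"
    and "norm (inv (\<lambda>x. x - B x) y) \<le> norm y / (1 - q)"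
proof -
  let ?N = "\<lambda>x. x - B x"
  have N: "bounded_clinear ?N"
    using B by (intro bounded_clinear_intros)
  have *: "(1 - q) * norm x \<le> norm (?N x)" for x
    using bound[of x] norm_triangle_ineq2[of x "B x"] by (simp add: algebra_simps)
  have "inj ?N"
  proof (rule injI)
    fix x y assume "?N x = ?N y"
    then have "?N (x - y) = 0"
      using bounded_clinear_diff[OF N, of x y] by simp
    then show "x = y"
      using *[of "x - y"] \<open>q < 1\<close> by (simp add: mult_le_0_iff)
  qed
  moreover have "surj ?N"
  proof (rule surjI)
    fix y
    have "\<exists>!x. y + B x = x"
    \<comment> \<open>The contraction principle asks for a non-negative constant, while
      \<open>q\<close> is only known to be below 1.\<close>
    proof (rule banach_fix_type[of "max q 0"])
      show "\<forall>x z. dist (y + B x) (y + B z) \<le> max q 0 * dist x z"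
        using bound by (simp add: dist_norm bounded_clinear_diff[OF B, symmetric])
          (meson max.cobounded1 mult_right_mono norm_ge_zero order_trans)
    qed (use \<open>q < 1\<close> in auto)
    then have "\<exists>x. ?N x = y"
      by (metis add_diff_cancel_right')
    then show "?N (SOME x. ?N x = y) = y"
      by (rule someI_ex)
  qed
  ultimately show bij: "bij ?N"
    by (rule bijI)
  have inv: "?N (inv ?N y) = y" "inv ?N (?N y) = y" for y
    using surj_f_inv_f[OF bij_is_surj[OF bij]] inv_f_f[OF bij_is_inj[OF bij]] by auto
  show le: "norm (inv ?N y) \<le> norm y / (1 - q)" for y
    using *[of "inv ?N y"] \<open>q < 1\<close> inv by (simp add: field_simps)
  have "inv ?N (x + y) = inv ?N x + inv ?N y" for x y
    using inv(2)[of "inv ?N x + inv ?N y"] bounded_clinear_add[OF N, of "inv ?N x" "inv ?N y"]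
    unfolding inv(1) by metis
  moreover have "inv ?N (c *\<^sub>C x) = c *\<^sub>C inv ?N x" for c x
    using inv(2)[of "c *\<^sub>C inv ?N x"] bounded_clinear_scaleC[OF N, of c "inv ?N x"]
    unfolding inv(1) by metis
  ultimately show "bounded_clinear (inv ?N)"
    unfolding bounded_clinear_def
    by (intro conjI bounded_linear_intro[of _ "1 / (1 - q)"])
      (use le in \<open>auto simp: scaleR_scaleC\<close>)
qed


section \<open>Vector-valued holomorphic functions\<close>

lemma vholomorphic_onD:
  assumes "vholomorphic_on \<gamma> U" "open U"
  obtains \<gamma>' where "\<And>w. w \<in> U \<Longrightarrow> (\<gamma> has_derivative (\<lambda>h. h *\<^sub>C \<gamma>' w)) (at w)"
  using assms unfolding vholomorphic_on_def by (metis at_within_open)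

lemma vholomorphic_onI:
  assumes "\<And>w. w \<in> U \<Longrightarrow> (\<gamma> has_derivative (\<lambda>h. h *\<^sub>C \<gamma>' w)) (at w)"
  shows "vholomorphic_on \<gamma> U"
  using assms unfolding vholomorphic_on_def by (metis has_derivative_at_withinI)

lemma vholomorphic_on_subset:
  "vholomorphic_on \<gamma> U \<Longrightarrow> V \<subseteq> U \<Longrightarrow> vholomorphic_on \<gamma> V"
  unfolding vholomorphic_on_def by (metis has_derivative_subset subset_iff)

lemma vholomorphic_on_imp_continuous_on:
  "vholomorphic_on \<gamma> U \<Longrightarrow> continuous_on U \<gamma>"
  unfolding vholomorphic_on_def continuous_on_eq_continuous_within
  using has_derivative_continuous by blast

lemma has_field_derivative_cinner:
  assumes "(\<gamma> has_derivative (\<lambda>h. h *\<^sub>C v)) F"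
  shows "((\<lambda>z. cinner (\<gamma> z) y) has_field_derivative cinner v y) F"
  unfolding has_field_derivative_def
  using bounded_linear.has_derivative[OF cinner.bounded_linear_left assms]
  by (rule has_derivative_eq_rhs) (simp add: cinner_scaleC_left mult.commute fun_eq_iff)

lemma vholomorphic_on_cinner:
  assumes "vholomorphic_on \<gamma> U"
  shows "(\<lambda>z. cinner (\<gamma> z) y) holomorphic_on U"
  using assms has_field_derivative_cinner
  unfolding vholomorphic_on_def holomorphic_on_def field_differentiable_def by blast

lemma vholomorphic_on_clinear:
  assumes "vholomorphic_on \<gamma> U" "bounded_clinear A"
  shows "vholomorphic_on (\<lambda>z. A (\<gamma> z)) U"
  using assms bounded_clinear_has_derivative unfolding vholomorphic_on_def by blast

lemma has_derivative_scaleC: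
  assumes "(f has_field_derivative f') (at w)" "(\<gamma> has_derivative (\<lambda>h. h *\<^sub>C v)) (at w)"
  shows "((\<lambda>z. f z *\<^sub>C \<gamma> z) has_derivative (\<lambda>h. h *\<^sub>C (f' *\<^sub>C \<gamma> w + f w *\<^sub>C v))) (at w)"
  using scaleC.FDERIV[OF assms(1)[unfolded has_field_derivative_def] assms(2)]
  by (rule has_derivative_eq_rhs)
     (simp add: scaleC_add_right scaleC_scaleC mult.commute fun_eq_iff)

text \<open>First-order Taylor formula for \<open>deriv f\<close>, with the remainder controlled by
  the third derivative of \<open>f\<close>. Discs of radius \<open>r/4\<close> about points of
  \<open>ball w (r/2)\<close> stay in \<open>ball w r\<close>, so the Cauchy estimate gives the
  constant \<open>3! * 4 ^ 3 = 384\<close>. The bound depends on \<open>f\<close> only through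
  \<open>B\<close>.\<close>

lemma deriv_difference_quotient_bound:
  fixes f :: "complex \<Rightarrow> complex"
  assumes hol: "f holomorphic_on ball w r" and bound: "\<And>z. z \<in> ball w r \<Longrightarrow> cmod (f z) \<le> B"
    and z: "z \<in> ball w (r/2)" "z \<noteq> w"
  shows "cmod ((deriv f z - deriv f w) / (z - w) - deriv (deriv f) w)
    \<le> 384 * B / r ^ 3 * cmod (z - w)"
proof -
  have r: "r > 0"
    using z by (metis ball_eq_empty empty_iff half_gt_zero_iff linorder_not_le)
  let ?S = "ball w (r/2)"
  let ?f = "\<lambda>i. (deriv ^^ Suc i) f"
  have "cmod (?f 0 z - (\<Sum>i\<le>1. ?f i w * (z - w) ^ i / fact i))
      \<le> 384 * B / r ^ 3 * cmod (z - w) ^ Suc 1 / fact 1"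
  proof (rule complex_Taylor[of ?S])
    show "(?f i has_field_derivative ?f (Suc i) x) (at x within ?S)" if "x \<in> ?S" for i x
    proof -
      have "?f i holomorphic_on ball w r"
        using hol by (intro holomorphic_higher_deriv) auto
      then have "(?f i has_field_derivative deriv (?f i) x) (at x)"
        using that r by (intro holomorphic_derivI[of _ "ball w r"]) auto
      then show ?thesis
        by (simp add: has_field_derivative_at_within)
    qed
    show "cmod (?f (Suc 1) x) \<le> 384 * B / r ^ 3" if x: "x \<in> ?S" for x
    proof -
      have sub: "cball x (r/4) \<subseteq> ball w r"
      proof
        fix u assume "u \<in> cball x (r/4)"
        then show "u \<in> ball w r"
          using x r dist_triangle[of w u x] by auto
      qed
      have "cmod ((deriv ^^ 3) f x) \<le> fact 3 * B / (r/4) ^ 3"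
      proof (rule Cauchy_inequality)
        show "f holomorphic_on ball x (r/4)" "continuous_on (cball x (r/4)) f"
          using hol sub holomorphic_on_subset holomorphic_on_imp_continuous_on
          by (meson ball_subset_cball order_trans, meson continuous_on_subset)
        show "\<And>u. cmod (x - u) = r/4 \<Longrightarrow> cmod (f u) \<le> B"
          using sub bound by (auto simp: dist_norm subset_iff)
      qed (use r in auto)
      then show ?thesis
        by (simp add: fact_numeral power_divide eval_nat_numeral)
    qed
  qed (use z r in auto)
  then have *: "cmod (deriv f z - deriv f w - deriv (deriv f) w * (z - w))
      \<le> 384 * B / r ^ 3 * cmod (z - w) * cmod (z - w)"
    by (simp add: algebra_simps power2_eq_square)
  have "(deriv f z - deriv f w) / (z - w) - deriv (deriv f) w
      = (deriv f z - deriv f w - deriv (deriv f) w * (z - w)) / (z - w)"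
    using z by (simp add: field_simps)
  then show ?thesis
    using * z by (simp add: norm_divide divide_le_eq)
qed

text \<open>
  The Cauchy estimates for the scalar functions \<open>\<lambda>z. cinner (\<gamma> z) y\<close> are uniform in \<open>y\<close>, so the
  difference quotients of the derivative satisfy the Cauchy criterion in norm.
\<close>

lemma vholomorphic_on_derivative:
  fixes \<gamma> :: "complex \<Rightarrow> 'a::chilbert_space"
  assumes "open U" and deriv: "\<And>w. w \<in> U \<Longrightarrow> (\<gamma> has_derivative (\<lambda>h. h *\<^sub>C \<gamma>' w)) (at w)"
  shows "vholomorphic_on \<gamma>' U"
  unfolding vholomorphic_on_def
proof
  fix w assume "w \<in> U"
  have vhol: "vholomorphic_on \<gamma> U"
    using deriv by (rule vholomorphic_onI)
  have "continuous (at w) \<gamma>"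
    using deriv[OF \<open>w \<in> U\<close>] has_derivative_continuous by blast
  then obtain d where d: "d > 0" "\<And>z. dist z w < d \<Longrightarrow> dist (\<gamma> z) (\<gamma> w) < 1"
    unfolding continuous_at_eps_delta by (metis zero_less_one)
  obtain e where e: "e > 0" "ball w e \<subseteq> U"
    using \<open>open U\<close> \<open>w \<in> U\<close> open_contains_ball by blast
  define r where "r = min d e"
  define M where "M = norm (\<gamma> w) + 1"
  have r: "r > 0" "ball w r \<subseteq> U"
    using d e by (auto simp: r_def)
  have M: "norm (\<gamma> z) \<le> M" if "z \<in> ball w r" for z
    using d(2)[of z] that norm_triangle_sub[of "\<gamma> z" "\<gamma> w"]
    by (simp add: M_def r_def dist_norm norm_minus_commute)
  define C where "C = 384 * M / r ^ 3"
  have "C \<ge> 0"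
    using r by (simp add: C_def M_def)
  define q where "q = (\<lambda>z. (1 / (z - w)) *\<^sub>C (\<gamma>' z - \<gamma>' w))"
  have q: "\<gamma>' z - \<gamma>' w = (z - w) *\<^sub>C q z" if "z \<noteq> w" for z
    using that by (simp add: q_def scaleC_scaleC scaleC_one)
  have derivs: "deriv (\<lambda>z. cinner (\<gamma> z) y) z = cinner (\<gamma>' z) y" if "z \<in> U" for y z
    using has_field_derivative_cinner[OF deriv[OF that]] by (rule DERIV_imp_deriv)
  have est: "\<exists>s. \<forall>z. z \<in> ball w (r/2) \<longrightarrow> z \<noteq> w \<longrightarrow>
      cmod (cinner (q z) y - s) \<le> C * norm y * cmod (z - w)" for y
  proof (intro exI allI impI)
    fix z assume z: "z \<in> ball w (r/2)" "z \<noteq> w"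
    let ?f = "\<lambda>z. cinner (\<gamma> z) y"
    have "cmod ((deriv ?f z - deriv ?f w) / (z - w) - deriv (deriv ?f) w)
        \<le> 384 * (M * norm y) / r ^ 3 * cmod (z - w)"
    proof (rule deriv_difference_quotient_bound[OF _ _ z])
      show "?f holomorphic_on ball w r"
        using vholomorphic_on_cinner[OF vhol] r(2) by (rule holomorphic_on_subset)
      show "cmod (?f x) \<le> M * norm y" if "x \<in> ball w r" for x
        using cmod_cinner_le[of "\<gamma> x" y] M[OF that] by (meson mult_right_mono norm_ge_zero order_trans)
    qed
    moreover have "z \<in> U"
      using z r by (auto simp: subset_iff)
    ultimately show "cmod (cinner (q z) y - deriv (deriv ?f) w) \<le> C * norm y * cmod (z - w)"
      using \<open>w \<in> U\<close> by (simp add: derivs q_def cinner_scaleC_left cinner.diff_left C_def mult_ac)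
  qed
  have cauchy: "norm (q z - q u) \<le> C * (cmod (z - w) + cmod (u - w))"
    if z: "z \<in> ball w (r/2)" "z \<noteq> w" and u: "u \<in> ball w (r/2)" "u \<noteq> w" for z u
  proof -
    \<comment> \<open>Testing with the difference itself turns the weak estimate into one in norm: a
      factor \<open>norm ?y\<close> cancels. The number \<open>s\<close> is the same for both points
      and drops out.\<close>
    let ?y = "q z - q u"
    obtain s where s: "\<And>z. z \<in> ball w (r/2) \<Longrightarrow> z \<noteq> w \<Longrightarrow>
        cmod (cinner (q z) ?y - s) \<le> C * norm ?y * cmod (z - w)"
      using est by blast
    have "norm ?y * norm ?y = cmod (cinner ?y ?y)"
      by (simp add: cinner_self power2_eq_square norm_mult)
    also have "\<dots> = cmod ((cinner (q z) ?y - s) - (cinner (q u) ?y - s))"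
      by (simp add: cinner.diff_left)
    also have "\<dots> \<le> C * norm ?y * cmod (z - w) + C * norm ?y * cmod (u - w)"
      using s[OF z] s[OF u] norm_triangle_ineq4 by (smt (verit))
    also have "\<dots> = norm ?y * (C * (cmod (z - w) + cmod (u - w)))"
      by (simp add: algebra_simps)
    finally show ?thesis
      using \<open>C \<ge> 0\<close> by (cases "?y = 0") auto
  qed
  \<comment> \<open>Any sequence in the half disc that tends to \<open>w\<close> without meeting it
    serves. It only produces the limit \<open>v\<close>; the estimate \<open>cauchy\<close> then
    controls every \<open>z\<close>.\<close>
  define h where "h = (\<lambda>n. w + of_real (r / 4 / real (Suc n)))"
  have hw: "cmod (h n - w) = r / 4 / real (Suc n)" for n
    unfolding h_def add_diff_cancel_left' norm_of_real using r by simp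
  have h: "h n \<in> ball w (r/2)" "h n \<noteq> w" for n
  proof -
    have "r / 4 / real (Suc n) \<le> r / 4"
      using r by (simp add: divide_le_eq field_simps)
    then show "h n \<in> ball w (r/2)"
      using r hw[of n] by (simp add: dist_norm norm_minus_commute)
    show "h n \<noteq> w"
      using hw[of n] r by force
  qed
  have lim0: "(\<lambda>n. cmod (h n - w)) \<longlonglongrightarrow> 0"
    unfolding hw using lim_const_over_n[of "r/4"] LIMSEQ_Suc by fastforce
  have "Cauchy (\<lambda>n. q (h n))"
  proof (rule metric_CauchyI)
    fix \<epsilon> :: real assume "\<epsilon> > 0"
    then have "\<epsilon> / (2 * C + 2) > 0"
      using \<open>C \<ge> 0\<close> by simp
    then obtain N where N: "\<And>n. n \<ge> N \<Longrightarrow> cmod (h n - w) < \<epsilon> / (2 * C + 2)"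
      using lim0 unfolding LIMSEQ_iff by fastforce
    show "\<exists>M. \<forall>m\<ge>M. \<forall>n\<ge>M. dist (q (h m)) (q (h n)) < \<epsilon>"
    proof (intro exI allI impI)
      fix m n assume "m \<ge> N" "n \<ge> N"
      then have "cmod (h m - w) + cmod (h n - w) \<le> 2 * (\<epsilon> / (2 * C + 2))"
        using N[of m] N[of n] by simp
      then have "C * (cmod (h m - w) + cmod (h n - w)) \<le> C * (2 * (\<epsilon> / (2 * C + 2)))"
        using \<open>C \<ge> 0\<close> by (intro mult_left_mono)
      also have "\<dots> < \<epsilon>"
        using \<open>C \<ge> 0\<close> \<open>\<epsilon> > 0\<close> by (simp add: field_simps)
      finally show "dist (q (h m)) (q (h n)) < \<epsilon>"
        using cauchy[OF h h, of m n] by (simp add: dist_norm)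
    qed
  qed
  then obtain v where v: "(\<lambda>n. q (h n)) \<longlonglongrightarrow> v"
    using Cauchy_convergent convergent_def by blast
  have qv: "norm (q z - v) \<le> C * cmod (z - w)" if z: "z \<in> ball w (r/2)" "z \<noteq> w" for z
  proof (rule LIMSEQ_le)
    show "(\<lambda>n. norm (q z - q (h n))) \<longlonglongrightarrow> norm (q z - v)"
      by (intro tendsto_intros v)
    show "(\<lambda>n. C * (cmod (z - w) + cmod (h n - w))) \<longlonglongrightarrow> C * cmod (z - w)"
      by (rule tendsto_eq_intros lim0 refl | simp)+
  qed (use cauchy[OF z h] in blast)
  have "(\<gamma>' has_derivative (\<lambda>h. h *\<^sub>C v)) (at w)"
    unfolding has_derivative_at_within
  proof (intro conjI)
    show "bounded_linear (\<lambda>h. h *\<^sub>C v)"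
      by (rule scaleC.bounded_linear_left)
    have "((\<lambda>z. (\<gamma>' z - \<gamma>' w - (z - w) *\<^sub>C v) /\<^sub>R norm (z - w)) \<longlongrightarrow> 0) (at w)"
    proof (rule Lim_null_comparison)
      show "((\<lambda>z. C * cmod (z - w)) \<longlongrightarrow> 0) (at w)"
        by (rule tendsto_eq_intros refl | simp)+
      show "\<forall>\<^sub>F z in at w. norm ((\<gamma>' z - \<gamma>' w - (z - w) *\<^sub>C v) /\<^sub>R norm (z - w)) \<le> C * cmod (z - w)"
        unfolding eventually_at
      proof (intro exI conjI ballI impI)
        show "0 < r/2" using r by simp
        fix z assume z: "z \<noteq> w \<and> dist z w < r/2"
        then have "\<gamma>' z - \<gamma>' w - (z - w) *\<^sub>C v = (z - w) *\<^sub>C (q z - v)"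
          by (simp add: q scaleC.diff_right)
          then have "norm ((\<gamma>' z - \<gamma>' w - (z - w) *\<^sub>C v) /\<^sub>R norm (z - w)) = norm (q z - v)"
            using z by (simp only: norm_scaleC norm_scaleR) simp
          then show "norm ((\<gamma>' z - \<gamma>' w - (z - w) *\<^sub>C v) /\<^sub>R norm (z - w)) \<le> C * cmod (z - w)"
            using qv[of z] z by (simp add: dist_commute)
      qed
    qed
    then show "((\<lambda>y. ((\<gamma>' y - \<gamma>' w) - (y - w) *\<^sub>C v) /\<^sub>R norm (y - w)) \<longlongrightarrow> 0) (at w)"
      by simp
  qed
  then show "\<exists>v. (\<gamma>' has_derivative (\<lambda>h. h *\<^sub>C v)) (at w within U)"
    using has_derivative_at_withinI by blast
qed


section \<open>The open mapping theorem and local sections\<close>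

text \<open>The Baire half of the open mapping theorem: some \<open>A n\<close> contains a ball, and
  taking the difference of two approximate preimages moves its centre to the origin.\<close>

lemma surj_approx_preimage:
  fixes N :: "'a::banach \<Rightarrow> 'b::banach"
  assumes N: "bounded_linear N" and "surj N"
  obtains K where "K > 0" "\<And>y e. e > 0 \<Longrightarrow> \<exists>x. norm x \<le> K * norm y \<and> norm (y - N x) < e"
proof -
  interpret N: bounded_linear N by fact
  define A where "A = (\<lambda>n::nat. closure (N ` cball 0 (real n)))"
  have union: "(\<Union>n. A n) = UNIV"
  proof -
    have "y \<in> (\<Union>n. A n)" for y
    proof -
      obtain x where "y = N x"
        using \<open>surj N\<close> by (meson surjD)
      moreover obtain n where "norm x \<le> real n"
        using real_arch_simple by blast
      ultimately have "y \<in> A n"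
        using closure_subset[of "N ` cball 0 (real n)"] by (auto simp: A_def)
      then show ?thesis by blast
    qed
    then show ?thesis by blast
  qed
  have "\<exists>n. interior (A n) \<noteq> {}"
  proof (rule ccontr)
    assume "\<nexists>n. interior (A n) \<noteq> {}"
    then have "(euclidean :: 'b topology) interior_of (\<Union>(range A)) = {}"
      by (intro Met_TC.metric_Baire_category_alt[unfolded mtopology_is_euclidean])
         (auto simp: A_def complete_UNIV)
    then show False
      using union by simp
  qed
  then obtain n y0 r where r: "r > 0" "ball y0 r \<subseteq> A n"
    by (meson ex_in_conv mem_interior)
  show thesis
  proof
    \<comment> \<open>A vector scaled to length \<open>r/2\<close> is approximated by the image of a
      difference of two vectors of norm at most \<open>n\<close>; scaling back gives
      \<open>4 n / r\<close>. The added 1 keeps \<open>K\<close> positive when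
      \<open>n = 0\<close>.\<close>
    define K where "K = 4 * (real n + 1) / r"
    show "K > 0"
      using r by (simp add: K_def)
    fix y and e :: real assume "e > 0"
    show "\<exists>x. norm x \<le> K * norm y \<and> norm (y - N x) < e"
    proof (cases "y = 0")
      case True
      then show ?thesis
        using \<open>e > 0\<close> by (intro exI[of _ 0]) (simp add: N.zero)
    next
      case False
      define t where "t = r / (2 * norm y)"
      have t: "t > 0"
        using r False by (simp add: t_def)
      have "norm (t *\<^sub>R y) < r"
        using r False by (simp add: t_def)
      then have "y0 + t *\<^sub>R y \<in> A n" "y0 \<in> A n"
        using r by (auto simp: dist_norm subset_iff)
      then obtain u v where uv: "norm u \<le> real n" "norm (y0 + t *\<^sub>R y - N u) < t * e / 2"
          "norm v \<le> real n" "norm (y0 - N v) < t * e / 2"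
        unfolding A_def closure_approachable using t \<open>e > 0\<close>
        by (auto simp: dist_norm norm_minus_commute dest!: spec[of _ "t * e / 2"])
      define x where "x = (1 / t) *\<^sub>R (u - v)"
      have "norm (t *\<^sub>R y - N (u - v)) < t * e"
        using norm_triangle_ineq4[of "y0 + t *\<^sub>R y - N u" "y0 - N v"] uv by (simp add: N.diff algebra_simps)
      moreover have "t *\<^sub>R y - N (u - v) = t *\<^sub>R (y - N x)"
        using t unfolding x_def N.scaleR by (simp add: scaleR_diff_right)
      ultimately have "norm (y - N x) < e"
        using t by simp
      moreover have "norm x \<le> K * norm y"
      proof -
        have "norm x = norm (u - v) / t"
          using t by (simp add: x_def)
        also have "\<dots> \<le> (2 * (real n + 1)) / t"
          using t uv norm_triangle_ineq4[of u v] by (intro divide_right_mono) auto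
        also have "\<dots> = K * norm y"
          using r False by (simp add: K_def t_def field_simps)
        finally show ?thesis .
      qed
      ultimately show ?thesis by blast
    qed
  qed
qed

text \<open>Successive correction: each step halves the residual, so the corrections are dominated
  by a geometric series. Their sum, which exists by completeness, is an exact preimage at the price
  of doubling the constant.\<close>

lemma surj_bounded_preimage:
  fixes N :: "'a::banach \<Rightarrow> 'b::banach"
  assumes N: "bounded_linear N" and "surj N"
  obtains K where "K > 0" "\<And>y. \<exists>x. N x = y \<and> norm x \<le> K * norm y"
proof -
  interpret N: bounded_linear N by fact
  obtain K where K: "K > 0" "\<And>y e. e > 0 \<Longrightarrow> \<exists>x. norm x \<le> K * norm y \<and> norm (y - N x) < e"
    using surj_approx_preimage[OF assms] by blast
  have "\<exists>x. N x = y \<and> norm x \<le> 2 * K * norm y" for y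
  proof (cases "y = 0")
    case True
    then show ?thesis by (intro exI[of _ 0]) (simp add: N.zero)
  next
    case False
    have "\<exists>x. norm x \<le> K * norm z \<and> (z \<noteq> 0 \<longrightarrow> norm (z - N x) \<le> norm z / 2) \<and>
        (z = 0 \<longrightarrow> x = 0)" for z
    proof (cases "z = 0")
      case True
      then show ?thesis by (intro exI[of _ 0]) simp
    next
      case False
      then show ?thesis
        using K(2)[of "norm z / 2" z] by (auto intro: less_imp_le)
    qed
    then obtain f where f: "\<And>z. norm (f z) \<le> K * norm z" "\<And>z. z \<noteq> 0 \<Longrightarrow> norm (z - N (f z)) \<le> norm z / 2"
        "f 0 = 0"
      by metis
    define s where "s = (\<lambda>n. ((\<lambda>z. z - N (f z)) ^^ n) y)"
    have s0: "s 0 = y" and sS: "s (Suc n) = s n - N (f (s n))" for n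
      by (simp_all add: s_def)
    have half: "norm (z - N (f z)) \<le> norm z / 2" for z
      using f(2)[of z] f(3) by (cases "z = 0") (auto simp: N.zero)
    have s: "norm (s n) \<le> norm y * (1/2) ^ n" for n
    proof (induction n)
      case (Suc n)
      then show ?case
        using half[of "s n"] by (simp add: sS)
    qed (simp add: s0)
    have fs: "norm (f (s n)) \<le> K * norm y * (1/2) ^ n" for n
      using f(1)[of "s n"] mult_left_mono[OF s[of n], of K] K(1) by (simp only: mult.assoc) linarith
    have geo: "(\<lambda>n. K * norm y * (1/2) ^ n) sums (K * norm y * 2)"
      using sums_mult[OF geometric_sums[of "1/2::real"], of "K * norm y"] by simp
    have summ: "summable (\<lambda>n. norm (f (s n)))"
      by (rule summable_comparison_test'[OF sums_summable[OF geo], of 0]) (use fs in auto)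
    define x where "x = (\<Sum>n. f (s n))"
    have sx: "(\<lambda>n. f (s n)) sums x"
      unfolding x_def using summable_norm_cancel[OF summ] by (rule summable_sums)
    have "norm x \<le> (\<Sum>n. norm (f (s n)))"
      unfolding x_def using summ by (rule summable_norm)
    also have "\<dots> \<le> K * norm y * 2"
      unfolding sums_unique[OF geo] by (rule suminf_le[OF fs summ sums_summable[OF geo]])
    finally have "norm x \<le> 2 * K * norm y"
      by simp
    moreover have "N x = y"
    proof -
      have "(\<lambda>n. N (f (s n))) sums N x"
        using sx by (rule N.sums)
      moreover have "(\<Sum>i<n. N (f (s i))) = y - s n" for n
        by (induction n) (auto simp: s0 sS)
      moreover have "s \<longlonglongrightarrow> 0"
      proof (rule Lim_null_comparison)
        show "(\<lambda>n. norm y * (1/2) ^ n) \<longlonglongrightarrow> 0"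
          by (intro tendsto_mult_right_zero LIMSEQ_power_zero) simp
      qed (use s in auto)
      ultimately have "(\<lambda>n. y - s n) \<longlonglongrightarrow> N x" "(\<lambda>n. y - s n) \<longlonglongrightarrow> y - 0"
        by (auto simp only: sums_def intro: tendsto_diff tendsto_const)
      then show ?thesis
        using LIMSEQ_unique by fastforce
    qed
    ultimately show ?thesis by blast
  qed
  then show thesis
    using that[of "2 * K"] K(1) by simp
qed

section \<open>One-dimensional eigenspaces and local holomorphic eigenvectors\<close>

lemma subspace_op_kernel: "bounded_clinear A \<Longrightarrow> complex_vector.subspace (op_kernel A)"
  by (auto simp: complex_vector.subspace_def op_kernel_def bounded_clinear_simps)

lemma mem_op_kernel_op_minus: "x \<in> op_kernel (op_minus A w) \<longleftrightarrow> A x = w *\<^sub>C x"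
  by (simp add: op_kernel_def op_minus_def)

lemma dim_1_iff_line:
  assumes "bounded_clinear A"
  shows "complex_vector.dim (op_kernel A) = 1 \<longleftrightarrow>
    (\<exists>v. v \<noteq> 0 \<and> op_kernel A = range (\<lambda>c. c *\<^sub>C v))"
proof
  assume 1: "complex_vector.dim (op_kernel A) = 1"
  obtain B where B: "B \<subseteq> op_kernel A" "complex_vector.independent B"
      "op_kernel A \<subseteq> complex_vector.span B" "card B = 1"
    using complex_vector.basis_exists[of "op_kernel A"] 1 by metis
  then obtain v where v: "B = {v}"
    by (meson card_1_singletonE)
  have "op_kernel A = complex_vector.span {v}"
    using B(1,3) complex_vector.span_minimal[OF _ subspace_op_kernel[OF assms]] v by blast
  moreover have "v \<noteq> 0"
    using B(2) v complex_vector.dependent_zero by blast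
  ultimately show "\<exists>v. v \<noteq> 0 \<and> op_kernel A = range (\<lambda>c. c *\<^sub>C v)"
    by (auto simp: complex_vector.span_singleton)
next
  assume "\<exists>v. v \<noteq> 0 \<and> op_kernel A = range (\<lambda>c. c *\<^sub>C v)"
  then obtain v where v: "v \<noteq> 0" "op_kernel A = complex_vector.span {v}"
    by (auto simp: complex_vector.span_singleton)
  have "complex_vector.dim (complex_vector.span {v}) = card {v}"
    using v(1) by (intro complex_vector.dim_span_eq_card_independent) simp
  then show "complex_vector.dim (op_kernel A) = 1"
    by (simp add: v(2))
qed

lemma cowen_douglas_1_kernel:
  assumes "cowen_douglas 1 \<Omega> A" "w \<in> \<Omega>"
  obtains v where "v \<noteq> 0" "op_kernel (op_minus A w) = range (\<lambda>c. c *\<^sub>C v)"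
  using assms dim_1_iff_line[OF bounded_clinear_op_minus, of A w]
  unfolding cowen_douglas_def by auto

lemma cowen_douglas_1_eigenvector_multiple:
  assumes "cowen_douglas 1 \<Omega> A" "w \<in> \<Omega>" "A x = w *\<^sub>C x" "A y = w *\<^sub>C y" "x \<noteq> 0"
  obtains c where "y = c *\<^sub>C x"
proof -
  obtain v where v: "op_kernel (op_minus A w) = range (\<lambda>c. c *\<^sub>C v)"
    using cowen_douglas_1_kernel assms(1,2) by metis
  obtain a b where ab: "x = a *\<^sub>C v" "y = b *\<^sub>C v"
    using assms(3,4) v unfolding mem_op_kernel_op_minus[symmetric] by blast
  then have "a \<noteq> 0"
    using \<open>x \<noteq> 0\<close> by auto
  then have "y = (b / a) *\<^sub>C x"
    by (simp add: ab scaleC_scaleC)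
  then show thesis by (rule that)
qed

text \<open>Preimages of controlled size need not depend linearly on \<open>y\<close>. Removing the
  component along \<open>v\<close> makes them orthogonal to the kernel, hence unique, and uniqueness
  forces linearity.\<close>

lemma bounded_right_inverse:
  fixes N :: "'a::chilbert_space \<Rightarrow> 'b::chilbert_space"
  assumes N: "bounded_clinear N" and "surj N" and ker: "op_kernel N = range (\<lambda>c. c *\<^sub>C v)"
  obtains B where "bounded_clinear B" "\<And>y. N (B y) = y"
proof -
  define P where "P = (\<lambda>x. x - (cinner x v / cinner v v) *\<^sub>C v)"
  have P_perp: "cinner (P x) v = 0" for x
    by (cases "v = 0") (simp_all add: P_def cinner.diff_left cinner_scaleC_left)
  have "N v = 0"
    using ker range_eqI[of v "\<lambda>c. c *\<^sub>C v" 1] by (simp add: scaleC_one op_kernel_def set_eq_iff)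
  then have NP: "N (P x) = N x" for x
    using N by (simp add: P_def bounded_clinear_simps)
  have P_le: "norm (P x) \<le> norm x" for x
  proof -
    have "orthogonal (P x) ((cinner x v / cinner v v) *\<^sub>C v)"
      unfolding orthogonal_def inner_eq_Re_cinner by (simp add: cinner_scaleC_right P_perp)
    then have "(norm x)\<^sup>2 = (norm (P x))\<^sup>2 + (norm ((cinner x v / cinner v v) *\<^sub>C v))\<^sup>2"
      using norm_add_Pythagorean[of "P x" "(cinner x v / cinner v v) *\<^sub>C v"] by (simp add: P_def)
    then show ?thesis
      by (metis le_add_same_cancel1 norm_ge_zero power2_le_imp_le zero_le_power2)
  qed
  have uniq: "x = x'" if "N x = N x'" "cinner x v = 0" "cinner x' v = 0" for x x'
  proof -
    have "N (x - x') = 0"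
      using N that by (simp add: bounded_clinear_simps)
    then obtain c where c: "x - x' = c *\<^sub>C v"
      using ker by (auto simp: op_kernel_def)
    have "cinner (x - x') (x - x') = 0"
      unfolding c cinner_scaleC_right using that by (simp add: c[symmetric] cinner.diff_left)
    then show ?thesis by simp
  qed
  obtain K where K: "K > 0" "\<And>y. \<exists>x. N x = y \<and> norm x \<le> K * norm y"
    using surj_bounded_preimage[OF bounded_clinear_linear[OF N] \<open>surj N\<close>] by blast
  define B where "B = (\<lambda>y. P (SOME x. N x = y \<and> norm x \<le> K * norm y))"
  have NB: "N (B y) = y" and "norm (B y) \<le> K * norm y" and perp: "cinner (B y) v = 0" for y
    using someI_ex[OF K(2)[of y]] P_le[of "SOME x. N x = y \<and> norm x \<le> K * norm y"]
    by (auto simp: B_def NP P_perp)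
  moreover have "B (x + y) = B x + B y" for x y
    by (rule uniq) (use N in \<open>simp_all add: bounded_clinear_simps NB perp cinner_add_left\<close>)
  moreover have sc: "B (c *\<^sub>C x) = c *\<^sub>C B x" for c x
    by (rule uniq) (use N in \<open>simp_all add: bounded_clinear_simps NB perp cinner_scaleC_left\<close>)
  ultimately have "bounded_clinear B"
    unfolding bounded_clinear_def
    by (intro conjI bounded_linear_intro[of _ K]) (auto simp: scaleR_scaleC mult.commute)
  then show thesis
    using NB by (rule that)
qed

text \<open>
  With a right inverse \<open>B\<close> of \<open>A - w\<^sub>0\<close>, the vector \<open>t z = (1 - (z - w\<^sub>0) B)\<^sup>-\<^sup>1 v\<close> satisfies
  \<open>(A - w\<^sub>0) t z = (z - w\<^sub>0) t z\<close>.
\<close>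

lemma cowen_douglas_1_local_section:
  assumes cd: "cowen_douglas 1 \<Omega> A" and "w0 \<in> \<Omega>"
  obtains t r where "r > 0" "ball w0 r \<subseteq> \<Omega>" "nonvanishing_section A (ball w0 r) t"
proof -
  have A: "bounded_clinear A" and "open \<Omega>" and surj: "surj (op_minus A w0)"
    using cd \<open>w0 \<in> \<Omega>\<close> by (auto simp: cowen_douglas_def)
  let ?N = "op_minus A w0"
  have N: "bounded_clinear ?N"
    using A by (rule bounded_clinear_op_minus)
  obtain v where v: "v \<noteq> 0" "op_kernel ?N = range (\<lambda>c. c *\<^sub>C v)"
    using cowen_douglas_1_kernel assms by metis
  then have "?N v = 0"
    using range_eqI[of v "\<lambda>c. c *\<^sub>C v" 1] by (simp add: scaleC_one op_kernel_def set_eq_iff)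
  obtain B where B: "bounded_clinear B" "\<And>y. ?N (B y) = y"
    using bounded_right_inverse[OF N surj v(2)] by blast
  obtain K where K: "K > 0" "\<And>x. norm (B x) \<le> K * norm x"
    using bounded_clinear_bound[OF B(1)] by blast
  obtain e where e: "e > 0" "ball w0 e \<subseteq> \<Omega>"
    using \<open>open \<Omega>\<close> \<open>w0 \<in> \<Omega>\<close> open_contains_ball by blast
  \<comment> \<open>Within this radius \<open>(z - w0) B\<close> has norm at most 1/2, so the
    Neumann inverse is bounded uniformly in \<open>z\<close>.\<close>
  define r where "r = min e (1 / (2 * K))"
  have r: "r > 0" "ball w0 r \<subseteq> \<Omega>"
    using e K by (auto simp: r_def)
  have half: "norm ((z - w0) *\<^sub>C B x) \<le> 1/2 * norm x" if "z \<in> ball w0 r" for z x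
  proof -
    have "cmod (z - w0) \<le> 1 / (2 * K)"
      using that by (auto simp: r_def dist_norm norm_minus_commute)
    then have "cmod (z - w0) * norm (B x) \<le> 1 / (2 * K) * (K * norm x)"
      using K by (intro mult_mono) auto
    then show ?thesis
      using K by (simp add: norm_scaleC)
  qed
  let ?M = "\<lambda>z x. x - (z - w0) *\<^sub>C B x"
  have cB: "bounded_clinear (\<lambda>x. (z - w0) *\<^sub>C B x)" for z
    using B(1) by (rule bounded_clinear_cmult)
  note neumann = bij_id_minus_contraction[OF cB half]
  have M: "?M z (inv (?M z) y) = y" "norm (inv (?M z) y) \<le> 2 * norm y" if "z \<in> ball w0 r" for y z
    using surj_f_inv_f[OF bij_is_surj[OF neumann(1)[OF that]]] neumann(3)[OF that, of y] by auto
  define t where "t = (\<lambda>z. inv (?M z) v)"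
  have t: "t z = v + (z - w0) *\<^sub>C B (t z)" if "z \<in> ball w0 r" for z
    using M(1)[OF that, of v] unfolding t_def by (metis diff_eq_eq)
  have le2: "norm x \<le> 2 * norm (?M z x)" if "z \<in> ball w0 r" for z x
    using half[OF that, of x] norm_triangle_ineq2[of x "(z - w0) *\<^sub>C B x"] by simp
  have deriv: "(t has_derivative (\<lambda>h. h *\<^sub>C inv (?M z) (B (t z)))) (at z)" if z: "z \<in> ball w0 r" for z
  proof -
    \<comment> \<open>Differentiating \<open>t z - (z - w0) B (t z) = v\<close> formally predicts
      this derivative: \<open>(1 - (z - w0) B) t' = B t\<close>.\<close>
    define u where "u = inv (?M z) (B (t z))"
    have u: "u = B (t z) + (z - w0) *\<^sub>C B u"
      using M(1)[OF z, of "B (t z)"] unfolding u_def by (metis diff_eq_eq)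
    have diff: "?M w (t w - t z) = (w - z) *\<^sub>C B (t z)" if "w \<in> ball w0 r" for w
    proof -
      have "t w - t z = (w - w0) *\<^sub>C B (t w) - (z - w0) *\<^sub>C B (t z)"
        using t[OF that] t[OF z] by (metis add_diff_cancel_left)
      then show ?thesis
        unfolding bounded_clinear_diff[OF B(1)] by (simp add: scaleC.diff_left scaleC.diff_right)
    qed
    have lip: "norm (t w - t z) \<le> 2 * norm (B (t z)) * norm (w - z)" if "w \<in> ball w0 r" for w
      using le2[OF that, of "t w - t z"] unfolding diff[OF that] by (simp add: norm_scaleC mult_ac)
    have err: "norm (t w - t z - (w - z) *\<^sub>C u) \<le> (4 * K * norm (B (t z)) * norm (w - z)) * norm (w - z)"
      if w: "w \<in> ball w0 r" for w
    proof -
      have "?M z (t w - t z - (w - z) *\<^sub>C u) = ?M z (t w - t z) - (w - z) *\<^sub>C ?M z u"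
        using B(1) by (simp add: bounded_clinear_simps scaleC.diff_right scaleC_scaleC mult.commute)
      also have "?M z u = B (t z)"
        using u by (metis add_diff_cancel_right')
      also have "?M z (t w - t z) = ?M w (t w - t z) + (w - z) *\<^sub>C B (t w - t z)"
        by (simp add: scaleC.diff_left)
      finally have "?M z (t w - t z - (w - z) *\<^sub>C u) = (w - z) *\<^sub>C B (t w - t z)"
        unfolding diff[OF w] by simp
      then have "norm (t w - t z - (w - z) *\<^sub>C u) \<le> 2 * (norm (w - z) * norm (B (t w - t z)))"
        using le2[OF z, of "t w - t z - (w - z) *\<^sub>C u"] by (simp add: norm_scaleC)
      also have "\<dots> \<le> 2 * (norm (w - z) * (K * (2 * norm (B (t z)) * norm (w - z))))"
        using K lip[OF w] by (intro mult_left_mono order_trans[OF K(2)]) auto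
      finally show ?thesis
        by (simp add: mult_ac)
    qed
    show ?thesis
      unfolding u_def[symmetric] has_derivative_at_within
    proof (intro conjI)
      show "bounded_linear (\<lambda>h. h *\<^sub>C u)"
        by (rule scaleC.bounded_linear_left)
      show "((\<lambda>w. (t w - t z - (w - z) *\<^sub>C u) /\<^sub>R norm (w - z)) \<longlongrightarrow> 0) (at z)"
      proof (rule Lim_null_comparison)
        show "((\<lambda>w. 4 * K * norm (B (t z)) * norm (w - z)) \<longlongrightarrow> 0) (at z)"
          by (rule tendsto_eq_intros refl | simp)+
        have "\<forall>\<^sub>F w in at z. w \<in> ball w0 r"
          using z by (intro eventually_at_in_open') auto
        then show "\<forall>\<^sub>F w in at z. norm ((t w - t z - (w - z) *\<^sub>C u) /\<^sub>R norm (w - z))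
            \<le> 4 * K * norm (B (t z)) * norm (w - z)"
          using eventually_neq_at_within[of z z UNIV]
        proof eventually_elim
          case (elim w)
          then show ?case
            using err[OF elim(1)] by (simp add: divide_inverse_commute[symmetric] divide_le_eq)
        qed
      qed
    qed
  qed
  have "nonvanishing_section A (ball w0 r) t"
    unfolding nonvanishing_section_def
  proof (intro conjI ballI)
    show "vholomorphic_on t (ball w0 r)"
      using deriv by (rule vholomorphic_onI)
    fix z assume z: "z \<in> ball w0 r"
    have "?N (t z) = (z - w0) *\<^sub>C t z"
      using \<open>?N v = 0\<close> by (subst t[OF z]) (simp add: bounded_clinear_simps[OF N] B(2))
    then show "t z \<in> op_kernel (op_minus A z)"
      by (simp add: op_kernel_def op_minus_def scaleC.diff_left)
    show "t z \<noteq> 0"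
      using t[OF z] v(1) B(1) by (auto simp: bounded_clinear_simps)
  qed
  then show thesis
    using r that by blast
qed


section \<open>Intertwiners\<close>

lemma nonvanishing_sectionD:
  assumes "nonvanishing_section A U t" "z \<in> U"
  shows "A (t z) = z *\<^sub>C t z" "t z \<noteq> 0"
  using assms by (auto simp: nonvanishing_section_def mem_op_kernel_op_minus)

lemma cowen_douglas_total:
  assumes cd: "cowen_douglas n \<Omega> A" and M: "bounded_clinear M"
    and zero: "\<And>w x. w \<in> \<Omega> \<Longrightarrow> A x = w *\<^sub>C x \<Longrightarrow> M x = 0"
  shows "M x = 0"
proof -
  let ?S = "\<Union>w\<in>\<Omega>. op_kernel (op_minus A w)"
  have "complex_vector.span ?S \<subseteq> op_kernel M"
    using zero by (intro complex_vector.span_minimal subspace_op_kernel[OF M]) (auto simp: mem_op_kernel_op_minus, simp add: op_kernel_def)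
  moreover have "closed (op_kernel M)"
    unfolding op_kernel_def
    using linear_continuous_on[OF bounded_clinear_linear[OF M]]
    by (intro closed_Collect_eq continuous_on_const)
  ultimately have "closure (complex_vector.span ?S) \<subseteq> op_kernel M"
    by (rule closure_minimal)
  then show ?thesis
    using cd by (auto simp: cowen_douglas_def op_kernel_def)
qed

text \<open>An identity theorem for a bundle whose sections are available only locally. The largest
  open set \<open>G\<close> over which \<open>M\<close> kills the eigenvectors is compared with its
  exterior \<open>G'\<close>. The disc of a local section either misses \<open>G\<close>, or meets
  it, and then \<open>cinner (M (t z)) y\<close> vanishes on an open subset and so on the whole
  disc. Connectedness decides.\<close>

lemma cowen_douglas_1_zero_on_open:
  assumes cd: "cowen_douglas 1 \<Omega> A" and M: "bounded_clinear M"
    and V: "open V" "V \<noteq> {}" "V \<subseteq> \<Omega>"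
    and zero: "\<And>w x. w \<in> V \<Longrightarrow> A x = w *\<^sub>C x \<Longrightarrow> M x = 0"
  shows "M x = 0"
proof -
  define kills where "kills = (\<lambda>W. \<forall>w\<in>W. \<forall>x. A x = w *\<^sub>C x \<longrightarrow> M x = 0)"
  define G where "G = \<Union>{W. open W \<and> W \<subseteq> \<Omega> \<and> kills W}"
  define G' where "G' = \<Union>{W. open W \<and> W \<subseteq> \<Omega> \<and> W \<inter> G = {}}"
  have "connected \<Omega>"
    using cd by (simp add: cowen_douglas_def)
  moreover have "open G" "open G'" "G \<inter> G' \<inter> \<Omega> = {}"
    unfolding G_def G'_def by blast+
  moreover have "\<Omega> \<subseteq> G \<union> G'"
  proof
    fix w assume w: "w \<in> \<Omega>"
    obtain t r where t: "r > 0" "ball w r \<subseteq> \<Omega>" "nonvanishing_section A (ball w r) t"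
      using cowen_douglas_1_local_section[OF cd w] by blast
    have w_ball: "w \<in> ball w r"
      using t(1) by simp
    show "w \<in> G \<union> G'"
    proof (cases "ball w r \<inter> G = {}")
      case True
      then have "ball w r \<subseteq> G'"
        using t(2) open_ball unfolding G'_def by blast
      then show ?thesis
        using w_ball by (rule subsetD[THEN UnI2])
    next
      case False
      have Mt: "M (t z) = 0" if z: "z \<in> ball w r" for z
      proof (rule cinner_all_zero)
        fix y
        show "cinner (M (t z)) y = 0"
        proof (rule analytic_continuation_open[of "ball w r \<inter> G" "ball w r" "\<lambda>z. cinner (M (t z)) y" "\<lambda>z. 0"])
          show "(\<lambda>z. cinner (M (t z)) y) holomorphic_on ball w r"
            using t(3) unfolding nonvanishing_section_def
            by (metis vholomorphic_on_cinner vholomorphic_on_clinear M)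
          show "\<And>z. z \<in> ball w r \<inter> G \<Longrightarrow> cinner (M (t z)) y = 0"
            using nonvanishing_sectionD(1)[OF t(3)] by (auto simp: G_def kills_def)
        qed (use z False \<open>open G\<close> in \<open>simp_all add: open_Int\<close>)
      qed
      have "kills (ball w r)"
        unfolding kills_def
      proof (intro ballI allI impI)
        fix z x assume z: "z \<in> ball w r" and "A x = z *\<^sub>C x"
        then obtain c where "x = c *\<^sub>C t z"
          using cowen_douglas_1_eigenvector_multiple[OF cd _ nonvanishing_sectionD(1)[OF t(3) z]]
            nonvanishing_sectionD(2)[OF t(3) z] t(2) by blast
        then show "M x = 0"
          using Mt[OF z] M by (simp add: bounded_clinear_scaleC)
      qed
      then have "ball w r \<subseteq> G"
        using t(2) open_ball unfolding G_def by blast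
      then show ?thesis
        using w_ball by (rule subsetD[THEN UnI1])
    qed
  qed
  moreover have "V \<subseteq> G"
    using V zero unfolding G_def kills_def by blast
  ultimately have "\<Omega> \<subseteq> G"
    using V connectedD[of \<Omega> G G'] by blast
  then have "M x = 0" if "w \<in> \<Omega>" "A x = w *\<^sub>C x" for w x
    using that unfolding G_def kills_def by blast
  then show ?thesis
    by (rule cowen_douglas_total[OF cd M])
qed

text \<open>On eigenvectors \<open>L\<close> acts as multiplication by a holomorphic function, so the composition can
  only vanish if one of the factors does.\<close>

lemma cowen_douglas_1_intertwiner_cancel:
  assumes A: "cowen_douglas 1 \<Omega> A" and B: "cowen_douglas 1 \<Omega> B"
    and L: "bounded_clinear L" "\<And>x. L (A x) = B (L x)" "L \<noteq> (\<lambda>x. 0)"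
    and M: "bounded_clinear M" "\<And>x. M (L x) = 0"
  shows "M y = 0"
proof -
  obtain w x0 where w: "w \<in> \<Omega>" "A x0 = w *\<^sub>C x0" "L x0 \<noteq> 0"
    using cowen_douglas_total[OF A L(1)] L(3) by (metis ext)
  obtain t r where t: "r > 0" "ball w r \<subseteq> \<Omega>" "nonvanishing_section A (ball w r) t"
    using cowen_douglas_1_local_section[OF A w(1)] by blast
  have eig: "z \<in> ball w r \<Longrightarrow> A (t z) = z *\<^sub>C t z" "z \<in> ball w r \<Longrightarrow> t z \<noteq> 0" for z
    using nonvanishing_sectionD[OF t(3)] by auto
  obtain c where "x0 = c *\<^sub>C t w"
    using cowen_douglas_1_eigenvector_multiple[OF A w(1) eig(1) w(2) eig(2)] t(1) by auto
  then have "L (t w) \<noteq> 0"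
    using w(3) L(1) by (auto simp: bounded_clinear_scaleC)
  \<comment> \<open>Where \<open>L (t z)\<close> is non-zero it spans the eigenspace of
    \<open>B\<close> for \<open>z\<close>, so \<open>M\<close> kills that whole eigenspace.\<close>
  define V where "V = ball w r \<inter> (\<lambda>z. L (t z)) -` (- {0})"
  have "continuous_on (ball w r) (\<lambda>z. L (t z))"
    using t(3) vholomorphic_on_imp_continuous_on[OF vholomorphic_on_clinear[OF _ L(1)]]
    by (simp add: nonvanishing_section_def)
  then have "open V"
    unfolding V_def by (intro continuous_open_preimage open_ball open_Compl closed_singleton)
  show ?thesis
  proof (rule cowen_douglas_1_zero_on_open[OF B M(1) \<open>open V\<close>])
    have "w \<in> V"
      using t(1) \<open>L (t w) \<noteq> 0\<close> by (simp add: V_def)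
    then show "V \<noteq> {}"
      by blast
    show "V \<subseteq> \<Omega>"
      using t(2) by (auto simp: V_def)
    fix z x assume z: "z \<in> V" "B x = z *\<^sub>C x"
    have "B (L (t z)) = z *\<^sub>C L (t z)"
      using z(1) eig L by (auto simp: V_def bounded_clinear_scaleC simp flip: L(2))
    then obtain c where "x = c *\<^sub>C L (t z)"
      using cowen_douglas_1_eigenvector_multiple[OF B _ _ z(2)] z(1) \<open>V \<subseteq> \<Omega>\<close> unfolding V_def by blast
    then show "M x = 0"
      using M by (simp add: bounded_clinear_scaleC)
  qed
qed

lemma power_div_fact_tendsto_0: "(\<lambda>n. K ^ n / fact n) \<longlonglongrightarrow> (0::real)"
  using summable_LIMSEQ_zero[OF summable_exp[of K]] by (simp add: divide_inverse mult.commute)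

text \<open>
  The Kleinecke-Shirokov theorem, in the form it takes on an eigenvector: with \<open>N = A - w\<close> the
  relation \<open>N Y = Y N + Z\<close> gives \<open>N\<^sup>m Y\<^sup>m x = m! Z\<^sup>m x\<close>.
\<close>

lemma commutator_eigenvalue_zero:
  fixes A :: "'a::chilbert_space \<Rightarrow> 'a"
  assumes A: "bounded_clinear A" and Y: "bounded_clinear Y" and Z: "bounded_clinear Z"
    and comm: "\<And>x. Z (A x) = A (Z x)" and ZY: "\<And>x. Z x = A (Y x) - Y (A x)"
    and x: "A x = w *\<^sub>C x" "Z x = g *\<^sub>C x" "x \<noteq> 0"
  shows "g = 0"
proof (rule ccontr)
  assume "g \<noteq> 0"
  define N where "N = op_minus A w"
  have N: "bounded_clinear N"
    unfolding N_def by (rule bounded_clinear_op_minus[OF A])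
  have NZ: "N (Z y) = Z (N y)" for y
    using Z by (simp add: N_def op_minus_def comm bounded_clinear_simps)
  have NY: "N (Y y) = Y (N y) + Z y" for y
    using Y by (simp add: N_def op_minus_def ZY bounded_clinear_simps)
  have Nx: "N x = 0"
    using x by (simp add: N_def op_minus_def)
  have NmZ: "(N ^^ m) (Z y) = Z ((N ^^ m) y)" for m y
    by (induction m) (simp_all add: NZ)
  \<comment> \<open>\<open>N\<close> commutes with \<open>Z\<close>, so moving
    \<open>N ^^ Suc m\<close> past \<open>Y\<close> produces \<open>Suc m\<close> equal
    terms.\<close>
  have leibniz: "(N ^^ Suc m) (Y y) = Y ((N ^^ Suc m) y) + of_nat (Suc m) *\<^sub>C Z ((N ^^ m) y)" for m y
  proof (induction m)
    case 0
    then show ?case by (simp add: NY scaleC_one)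
  next
    case (Suc m)
    have "(N ^^ Suc (Suc m)) (Y y) = N ((N ^^ Suc m) (Y y))" by simp
    also have "\<dots> = N (Y ((N ^^ Suc m) y)) + of_nat (Suc m) *\<^sub>C N (Z ((N ^^ m) y))"
      unfolding Suc.IH by (simp only: bounded_clinear_add[OF N] bounded_clinear_scaleC[OF N])
    also have "\<dots> = Y ((N ^^ Suc (Suc m)) y) + (1 + of_nat (Suc m)) *\<^sub>C Z ((N ^^ Suc m) y)"
      unfolding NY NZ scaleC_add_left by (simp add: scaleC_one add.assoc del: of_nat_Suc)
    finally show ?case unfolding of_nat_Suc[symmetric] .
  qed
  have key: "(N ^^ m) ((Y ^^ m) x) = (fact m * g ^ m) *\<^sub>C x" for m
  proof (induction m)
    case 0
    then show ?case by (simp add: scaleC_one)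
  next
    case (Suc m)
    \<comment> \<open>By induction \<open>(N ^^ m) ((Y ^^ m) x)\<close> is a multiple of
      \<open>x\<close>, which \<open>N\<close> kills; only the term with \<open>Z\<close> survives
      in \<open>leibniz\<close>.\<close>
    have "(N ^^ Suc m) ((Y ^^ m) x) = 0"
      by (simp add: Suc bounded_clinear_simps[OF N] Nx)
    then show ?case
      using leibniz[of m "(Y ^^ m) x"] Suc
      by (simp add: bounded_clinear_simps[OF Z] bounded_clinear_simps[OF Y] x scaleC_scaleC mult_ac del: of_nat_Suc)
  qed
  obtain a where a: "a > 0" "\<And>y. norm (N y) \<le> a * norm y"
    using bounded_clinear_bound[OF N] by blast
  obtain b where b: "b > 0" "\<And>y. norm (Y y) \<le> b * norm y"
    using bounded_clinear_bound[OF Y] by blast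
  have pow: "norm ((F ^^ m) y) \<le> c ^ m * norm y"
    if "c > 0" "\<And>y. norm (F y) \<le> c * norm y" for F :: "'a \<Rightarrow> 'a" and c m y
  proof (induction m)
    case (Suc m)
    have "norm ((F ^^ Suc m) y) \<le> c * norm ((F ^^ m) y)"
      by (simp add: that(2))
    also have "\<dots> \<le> c * (c ^ m * norm y)"
      using Suc that(1) by (intro mult_left_mono) auto
    finally show ?case by (simp add: mult.assoc)
  qed simp
  \<comment> \<open>The left side of \<open>key\<close> grows at most geometrically in norm, the
    right side like a factorial as long as \<open>g\<close> is non-zero.\<close>
  have "1 \<le> (a * b / cmod g) ^ m / fact m" for m
  proof -
    have "fact m * cmod g ^ m * norm x = norm ((N ^^ m) ((Y ^^ m) x))"
      unfolding key norm_scaleC norm_mult norm_power by simp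
    also have "\<dots> \<le> a ^ m * (b ^ m * norm x)"
      using pow[OF a, of m "(Y ^^ m) x"] pow[OF b, of m x] a
      by (meson mult_left_mono order_trans zero_le_power less_imp_le)
    finally have "fact m * cmod g ^ m \<le> (a * b) ^ m"
      using x(3) by (simp add: power_mult_distrib mult.assoc[symmetric])
    then show ?thesis
      using \<open>g \<noteq> 0\<close> by (simp add: power_divide field_simps)
  qed
  then have "1 \<le> (0::real)"
    using LIMSEQ_le_const[OF power_div_fact_tendsto_0] by blast
  then show False by simp
qed

section \<open>Upper triangular form of intertwiners\<close>

definition maps_left_summand :: "('a::zero \<times> 'b::zero \<Rightarrow> 'c \<times> 'd::zero) \<Rightarrow> bool" where
  "maps_left_summand U \<longleftrightarrow> (\<forall>x. snd (U (x, 0)) = 0)"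

text \<open>In infinite dimensions the inverse of a triangular operator need not be triangular. Here
  the lower left entry of \<open>Q\<close> vanishes on the range of \<open>L\<close>, the upper left
  entry of \<open>U\<close>; as \<open>L\<close> is a non-zero intertwiner from \<open>R0\<close> to
  \<open>T0\<close>, it can be cancelled.\<close>

lemma FB2_maps_left_summand_inverse:
  fixes U :: "'c::{chilbert_space,second_countable_topology} \<times> 'd::{chilbert_space,second_countable_topology}
    \<Rightarrow> 'a::{chilbert_space,second_countable_topology} \<times> 'b::{chilbert_space,second_countable_topology}"
  assumes T: "FB2 \<Omega> T0 S T1" and R: "FB2 \<Omega> R0 S' R1"
    and U: "bounded_clinear U" "\<And>p. U (block_op R0 S' R1 p) = block_op T0 S T1 (U p)"
    and Q: "bounded_clinear Q" "\<And>p. Q (block_op T0 S T1 p) = block_op R0 S' R1 (Q p)"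
    and inv: "\<And>p. Q (U p) = p" and U0: "maps_left_summand U"
  shows "maps_left_summand Q"
proof -
  define L where "L = (\<lambda>x. fst (U (x, 0)))"
  have L: "bounded_clinear L"
    unfolding L_def by (intro bounded_clinear_compose[OF bounded_clinear_fst]
        bounded_clinear_compose[OF U(1)] bounded_clinear_intros)
  have UL: "U (x, 0) = (L x, 0)" for x
    using U0 by (simp add: L_def maps_left_summand_def prod_eq_iff)
  have M: "bounded_clinear (\<lambda>x. snd (Q (x, 0)))"
    by (intro bounded_clinear_compose[OF bounded_clinear_snd]
        bounded_clinear_compose[OF Q(1)] bounded_clinear_intros)
  have R01: "cowen_douglas 1 \<Omega> R0" "bounded_clinear S'" "bounded_clinear R1"
    and T01: "cowen_douglas 1 \<Omega> T0" "bounded_clinear S" "bounded_clinear T1"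
    using R T by (auto simp: FB2_def cowen_douglas_def)
  have "snd (Q (y, 0)) = 0" for y
  proof (rule cowen_douglas_1_intertwiner_cancel[OF R01(1) T01(1) L _ _ M])
    show "L (R0 x) = T0 (L x)" for x
      using U(2)[of "(x, 0)"] by (simp add: block_op_def UL bounded_clinear_simps[OF R01(2)]
          bounded_clinear_simps[OF R01(3)] bounded_clinear_simps[OF T01(2)] bounded_clinear_simps[OF T01(3)])
    show "snd (Q (L x, 0)) = 0" for x
      using inv[of "(x, 0)"] by (simp add: UL)
    show "L \<noteq> (\<lambda>x. 0)"
    proof
      assume L0: "L = (\<lambda>x. 0)"
      have "x = 0" for x :: 'c
      proof -
        have "(x, 0) = Q (U (x, 0))"
          by (rule inv[symmetric])
        also have "\<dots> = Q 0"
          unfolding UL L0 zero_prod_def ..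
        finally show ?thesis
          using bounded_clinear_zero[OF Q(1)] by (simp add: zero_prod_def)
      qed
      moreover have "S' \<noteq> (\<lambda>y. 0)"
        using R by (simp add: FB2_def)
      ultimately show False by auto
    qed
  qed
  then show ?thesis
    by (simp add: maps_left_summand_def)
qed


text \<open>Combines the lower left entries of \<open>U\<close> and of its inverse \<open>Q\<close>,
  since one alone only relates \<open>T1\<close> to the different operator \<open>R1\<close>. For a
  unitary \<open>U\<close> the conclusion amounts to block diagonal form.\<close>

lemma FB2_intertwiner_maps_left_summand:
  fixes U :: "'c::{chilbert_space,second_countable_topology} \<times> 'd::{chilbert_space,second_countable_topology}
    \<Rightarrow> 'a::{chilbert_space,second_countable_topology} \<times> 'b::{chilbert_space,second_countable_topology}"
  assumes T: "FB2 \<Omega> T0 S T1" and R: "FB2 \<Omega> R0 S' R1"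
    and U: "bounded_clinear U" "\<And>p. U (block_op R0 S' R1 p) = block_op T0 S T1 (U p)"
    and Q: "bounded_clinear Q" "\<And>p. Q (block_op T0 S T1 p) = block_op R0 S' R1 (Q p)"
    and inv: "\<And>p. Q (U p) = p" "\<And>p. U (Q p) = p"
  shows "maps_left_summand U \<and> maps_left_summand Q"
proof -
  have R01: "cowen_douglas 1 \<Omega> R0" "cowen_douglas 1 \<Omega> R1" "bounded_clinear R1"
      "bounded_clinear S'" "S' \<noteq> (\<lambda>y. 0)" "\<And>y. S' (R1 y) = R0 (S' y)"
    and T01: "cowen_douglas 1 \<Omega> T0" "cowen_douglas 1 \<Omega> T1" "bounded_clinear T1"
      "bounded_clinear S" "S \<noteq> (\<lambda>y. 0)" "\<And>y. S (T1 y) = T0 (S y)"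
    using R T by (auto simp: FB2_def cowen_douglas_def fun_eq_iff)
  have R0: "bounded_clinear R0"
    using R01(1) by (simp add: cowen_douglas_def)
  define X where "X = (\<lambda>x. snd (U (x, 0)))"
  define Y where "Y = (\<lambda>y. snd (U (0, y)))"
  define W where "W = (\<lambda>x. snd (Q (x, 0)))"
  have lin: "bounded_clinear (\<lambda>x. snd (F (x, 0)))" "bounded_clinear (\<lambda>y. snd (F (0, y)))"
    if "bounded_clinear F" for F :: "'e::chilbert_space \<times> 'f::chilbert_space \<Rightarrow> 'g::chilbert_space \<times> 'h::chilbert_space"
    by (intro bounded_clinear_compose[OF bounded_clinear_snd]
        bounded_clinear_compose[OF that] bounded_clinear_intros)+
  have X: "bounded_clinear X" and Y: "bounded_clinear Y" and W: "bounded_clinear W"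
    unfolding X_def Y_def W_def using lin U(1) Q(1) by blast+
  have XR: "X (R0 x) = T1 (X x)" for x
    using arg_cong[OF U(2)[of "(x, 0)"], of snd]
    by (simp add: X_def block_op_def split_beta bounded_clinear_zero R01 T01)
  have WT: "W (T0 x) = R1 (W x)" for x
    using arg_cong[OF Q(2)[of "(x, 0)"], of snd]
    by (simp add: W_def block_op_def split_beta bounded_clinear_zero R01 T01)
  \<comment> \<open>The lower right entry of the intertwining relation for \<open>U\<close>.\<close>
  have XS: "X (S' y) = T1 (Y y) - Y (R1 y)" for y
  proof -
    have "U (S' y, R1 y) = U (S' y, 0) + U (0, R1 y)"
      by (subst bounded_clinear_add[OF U(1), symmetric]) simp
    then show ?thesis
      using arg_cong[OF U(2)[of "(0, y)"], of snd]
      by (simp add: X_def Y_def block_op_def split_beta bounded_clinear_zero[OF R0] eq_diff_eq)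
  qed
  define V where "V = (\<lambda>y. W (S y))"
  define Z where "Z = (\<lambda>y. X (S' y))"
  have V: "bounded_clinear V" and Z: "bounded_clinear Z"
    unfolding V_def Z_def using X W R01(4) T01(4) by (auto intro: bounded_clinear_compose)
  have VT: "V (T1 y) = R1 (V y)" for y
    by (simp add: V_def T01(6) WT)
  have ZR: "Z (R1 y) = T1 (Z y)" for y
    by (simp add: Z_def R01(6) XR)
  have ZV: "Z (V y) = 0" for y
  proof (rule cowen_douglas_total[OF T01(2) bounded_clinear_compose[OF Z V]])
    fix w x assume w: "w \<in> \<Omega>" "T1 x = w *\<^sub>C x"
    show "Z (V x) = 0"
    proof (cases "x = 0")
      case False
      have "T1 (Z (V x)) = w *\<^sub>C Z (V x)"
        using w(2) by (simp add: bounded_clinear_scaleC V Z flip: ZR VT)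
      then obtain g where g: "Z (V x) = g *\<^sub>C x"
        using cowen_douglas_1_eigenvector_multiple[OF T01(2) w] False by metis
      have "g = 0"
      proof (rule commutator_eigenvalue_zero[OF T01(3)])
        show "bounded_clinear (\<lambda>y. Y (V y))" "bounded_clinear (\<lambda>y. Z (V y))"
          using V Y Z by (auto intro: bounded_clinear_compose)
        show "Z (V (T1 x)) = T1 (Z (V x))" for x
          by (simp add: VT ZR)
        \<comment> \<open>\<open>R1 V = V T1\<close> turns \<open>Y R1 V\<close> into
          \<open>(Y V) T1\<close>, so this is a commutator of \<open>T1\<close> with
          \<open>Y V\<close>.\<close>
        show "Z (V x) = T1 (Y (V x)) - Y (V (T1 x))" for x
          by (simp add: Z_def XS VT)
      qed (use w g False in auto)
      then show ?thesis
        using g by simp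
    qed (simp add: bounded_clinear_zero V Z)
  qed
  show ?thesis
  \<comment> \<open>From \<open>Z V = 0\<close> one factor vanishes. Cancelling \<open>S\<close>
    from \<open>V = W S\<close>, or \<open>S'\<close> from \<open>Z = X S'\<close>, makes
    \<open>Q\<close> or \<open>U\<close> triangular; the other one follows.\<close>
  proof (cases "V = (\<lambda>y. 0)")
    case True
    have "W x = 0" for x
      using cowen_douglas_1_intertwiner_cancel[OF T01(2) T01(1) T01(4) T01(6) T01(5) W] True
      by (simp add: V_def fun_eq_iff)
    then have "maps_left_summand Q"
      by (simp add: maps_left_summand_def W_def)
    then show ?thesis
      using FB2_maps_left_summand_inverse[OF R T Q U inv(2)] by blast
  next
    case False
    have "Z y = 0" for y
      using cowen_douglas_1_intertwiner_cancel[OF T01(2) R01(2) V VT False Z] ZV by simp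
    then have "X x = 0" for x
      using cowen_douglas_1_intertwiner_cancel[OF R01(2) R01(1) R01(4) R01(6) R01(5) X]
      by (simp add: Z_def)
    then have "maps_left_summand U"
      by (simp add: maps_left_summand_def X_def)
    then show ?thesis
      using FB2_maps_left_summand_inverse[OF T R U Q inv(1)] by blast
  qed
qed


section \<open>Disc automorphisms and functional calculus\<close>

lemma eigenvalue_in_spectrum:
  assumes "op_minus A w x = 0" "x \<noteq> 0"
  shows "w \<in> spectrum A"
proof -
  have False if "bounded_clinear R" "R \<circ> op_minus A w = id" for R
    using fun_cong[OF that(2), of x] fun_cong[OF that(2), of 0] assms bounded_clinear_zero[OF that(1)]
    by simp
  then show ?thesis
    unfolding spectrum_def by blast
qed

lemma affine_op_inverse:
  assumes A: "bounded_clinear A" "\<And>x. norm (A x) \<le> K * norm x" "K \<ge> 0"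
    and cd: "cmod c * K < cmod d"
  obtains P where "bounded_clinear P" "\<And>x. P (c *\<^sub>C A x + d *\<^sub>C x) = x"
    "\<And>x. c *\<^sub>C A (P x) + d *\<^sub>C P x = x"
proof -
  let ?B = "\<lambda>x. (- c / d) *\<^sub>C A x"
  let ?N = "\<lambda>x. x - ?B x"
  have B: "bounded_clinear ?B"
    by (intro bounded_clinear_cmult A)
  have "cmod d > 0"
    using cd A(3) by (meson le_less_trans mult_nonneg_nonneg norm_ge_zero)
  then have "d \<noteq> 0"
    by simp
  have *: "c *\<^sub>C A x + d *\<^sub>C x = d *\<^sub>C ?N x" for x
    using \<open>d \<noteq> 0\<close> by (simp add: scaleC.add_right scaleC_scaleC scaleC.minus_left add.commute)
  have bound: "norm (?B x) \<le> (cmod c * K / cmod d) * norm x" for x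
    using mult_left_mono[OF A(2)[of x], of "cmod c / cmod d"]
    by (simp add: norm_scaleC norm_divide)
  have "cmod c * K / cmod d < 1"
    using cd \<open>cmod d > 0\<close> by simp
  note neumann = bij_id_minus_contraction[OF B bound this]
  have inv: "?N (inv ?N y) = y" "inv ?N (?N y) = y" for y
    using surj_f_inv_f[OF bij_is_surj[OF neumann(1)]] inv_f_f[OF bij_is_inj[OF neumann(1)]] by auto
  show thesis
  proof
    show "bounded_clinear (\<lambda>x. inv ?N ((1 / d) *\<^sub>C x))"
      by (intro bounded_clinear_compose[OF neumann(2)] bounded_clinear_intros)
    show "inv ?N ((1 / d) *\<^sub>C (c *\<^sub>C A x + d *\<^sub>C x)) = x" for x
      unfolding * scaleC_scaleC using \<open>d \<noteq> 0\<close> inv(2) by (simp add: scaleC_one)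
    show "c *\<^sub>C A (inv ?N ((1 / d) *\<^sub>C x)) + d *\<^sub>C inv ?N ((1 / d) *\<^sub>C x) = x" for x
      unfolding * inv(1) scaleC_scaleC using \<open>d \<noteq> 0\<close> by (simp add: scaleC_one)
  qed
qed

text \<open>The difference of the squares factors as \<open>(|a|^2 - |b|^2) (1 - |z|^2)\<close>. The
  strict inequality yields both that the disc is mapped into itself and that the denominator has no
  zero there.\<close>

lemma norm_Moebius_less:
  assumes "cmod b < cmod a" "cmod z < 1"
  shows "cmod (a * z + b) < cmod (cnj b * z + cnj a)"
proof -
  have "(cmod (cnj b * z + cnj a))\<^sup>2 - (cmod (a * z + b))\<^sup>2 = ((cmod a)\<^sup>2 - (cmod b)\<^sup>2) * (1 - (cmod z)\<^sup>2)"
    unfolding cmod_power2 by (simp add: power2_eq_square algebra_simps)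
  also have "\<dots> > 0"
    using assms by (intro mult_pos_pos) (auto simp: power_strict_mono power_less_one_iff abs_square_less_1)
  finally show ?thesis
    by (simp add: power2_less_imp_less)
qed

lemma Moebius_denominator_nonzero:
  assumes "cmod b < cmod a" "cmod z < 1"
  shows "cnj b * z + cnj a \<noteq> 0"
  using norm_Moebius_less[OF assms] by (metis norm_ge_zero norm_zero not_less)

lemma Moebius_image_disc:
  assumes ab: "cmod b < cmod a"
  shows "linear_fractional a b (cnj b) (cnj a) ` ball 0 1 = ball 0 1"
proof -
  have maps: "linear_fractional a b (cnj b) (cnj a) z \<in> ball 0 1"
    if "cmod b < cmod a" "z \<in> ball 0 1" for a b z
    using norm_Moebius_less[OF that(1), of z] that(2)
    by (simp add: linear_fractional_def norm_divide divide_less_eq)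
  have D: "a * cnj a - b * cnj b \<noteq> 0"
    using ab by (simp add: complex_norm_square[symmetric] flip: of_real_power of_real_diff)
  have "z \<in> linear_fractional a b (cnj b) (cnj a) ` ball 0 1" if z: "z \<in> ball 0 1" for z
  proof
    \<comment> \<open>The inverse transformation, with \<open>cnj a\<close> and \<open>- b\<close>
      in the places of \<open>a\<close> and \<open>b\<close>, has the same form and so maps the disc
      into itself as well.\<close>
    let ?u = "linear_fractional (cnj a) (- b) (cnj (- b)) (cnj (cnj a)) z"
    show "?u \<in> ball 0 1"
      using maps[of "- b" "cnj a" z] ab z by simp
    have nz: "a - cnj b * z \<noteq> 0"
      using Moebius_denominator_nonzero[of "- b" "cnj a" z] ab z by (simp add: algebra_simps)
    have u: "?u = (cnj a * z - b) / (a - cnj b * z)"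
      by (simp add: linear_fractional_def)
    have num: "a * ?u + b = (a * cnj a - b * cnj b) * z / (a - cnj b * z)"
      unfolding u using nz by (simp add: field_simps)
    have den: "cnj b * ?u + cnj a = (a * cnj a - b * cnj b) / (a - cnj b * z)"
      unfolding u using nz by (simp add: field_simps)
    show "z = linear_fractional a b (cnj b) (cnj a) ?u"
      unfolding linear_fractional_def[of a b "cnj b" "cnj a"] num den using D nz by simp
  qed
  then show ?thesis
    using maps[OF ab] by blast
qed

text \<open>If \<open>P = (c A + d)\<^sup>-\<^sup>1\<close>, then \<open>\<lambda>x. a *\<^sub>C A (P x) + b *\<^sub>C P x\<close> is the linear fractional
  transform of \<open>A\<close>.\<close>

lemma linear_fractional_op_minus:
  assumes A: "bounded_clinear A" and P: "bounded_clinear P"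
    and PM: "\<And>x. P (c *\<^sub>C A x + d *\<^sub>C x) = x" and MP: "\<And>x. c *\<^sub>C A (P x) + d *\<^sub>C P x = x"
    and z: "c * z + d \<noteq> 0"
  shows "op_minus (\<lambda>x. a *\<^sub>C A (P x) + b *\<^sub>C P x) (linear_fractional a b c d z) x
    = ((a * d - b * c) / (c * z + d)) *\<^sub>C op_minus A z (P x)"
proof -
  let ?\<phi> = "linear_fractional a b c d z" and ?k = "(a * d - b * c) / (c * z + d)"
  \<comment> \<open>Writing \<open>x = (c A + d) P x\<close> puts everything over the common vector
    \<open>P x\<close>, where the terms combine to a multiple of \<open>A - z\<close>.\<close>
  have "op_minus (\<lambda>x. a *\<^sub>C A (P x) + b *\<^sub>C P x) ?\<phi> x
      = a *\<^sub>C A (P x) + b *\<^sub>C P x - ?\<phi> *\<^sub>C (c *\<^sub>C A (P x) + d *\<^sub>C P x)"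
    by (simp add: op_minus_def MP)
  also have "\<dots> = (a - ?\<phi> * c) *\<^sub>C A (P x) + (b - ?\<phi> * d) *\<^sub>C P x"
    by (simp add: scaleC_scaleC scaleC.diff_left scaleC.add_right algebra_simps)
  also have "a - ?\<phi> * c = ?k"
    using z by (simp add: linear_fractional_def field_simps)
  also have "b - ?\<phi> * d = - (?k * z)"
    using z by (simp add: linear_fractional_def field_simps)
  finally show ?thesis
    by (simp add: op_minus_def scaleC_scaleC scaleC.diff_right)
qed

lemma commutes_with_inverse:
  assumes A: "bounded_clinear A" and P: "bounded_clinear P"
    and PM: "\<And>x. P (c *\<^sub>C A x + d *\<^sub>C x) = x" and MP: "\<And>x. c *\<^sub>C A (P x) + d *\<^sub>C P x = x"
  shows "P (A x) = A (P x)"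
proof -
  have "P (A x) = P (A (c *\<^sub>C A (P x) + d *\<^sub>C P x))"
    by (simp only: MP)
  also have "\<dots> = P (c *\<^sub>C A (A (P x)) + d *\<^sub>C A (P x))"
    by (simp only: bounded_clinear_simps[OF A])
  finally show ?thesis
    by (simp only: PM)
qed

text \<open>The operator \<phi>(A) - \<phi>(z) is a non-zero multiple of \<open>P (A - z)\<close>,
  and \<open>P\<close> is injective.\<close>

lemma linear_fractional_op_eigen:
  assumes A: "bounded_clinear A" and P: "bounded_clinear P"
    and PM: "\<And>x. P (c *\<^sub>C A x + d *\<^sub>C x) = x" and MP: "\<And>x. c *\<^sub>C A (P x) + d *\<^sub>C P x = x"
    and z: "c * z + d \<noteq> 0" and D: "a * d - b * c \<noteq> 0"
  shows "op_kernel (op_minus (\<lambda>x. a *\<^sub>C A (P x) + b *\<^sub>C P x) (linear_fractional a b c d z))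
    = op_kernel (op_minus A z)"
proof -
  have "op_minus A z (P x) = P (op_minus A z x)" for x
    by (simp add: op_minus_def bounded_clinear_simps[OF P] commutes_with_inverse[OF A P PM MP])
  moreover have "P y = 0 \<longleftrightarrow> y = 0" for y
    using MP[of y] bounded_clinear_zero[OF P] bounded_clinear_zero[OF A] by auto
  ultimately show ?thesis
    using z D by (simp add: op_kernel_def linear_fractional_op_minus[OF A P PM MP z])
qed

text \<open>The eigenspaces are those of \<open>A\<close> relabelled by \<phi>, which maps
  \<open>\<Omega>\<close> onto itself; so their dimension and the density of their span carry
  over.\<close>

lemma cowen_douglas_1_linear_fractional:
  assumes cd: "cowen_douglas 1 \<Omega> A" and P: "bounded_clinear P"
    and PM: "\<And>x. P (c *\<^sub>C A x + d *\<^sub>C x) = x" and MP: "\<And>x. c *\<^sub>C A (P x) + d *\<^sub>C P x = x"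
    and z: "\<And>z. z \<in> \<Omega> \<Longrightarrow> c * z + d \<noteq> 0" and D: "a * d - b * c \<noteq> 0"
    and img: "linear_fractional a b c d ` \<Omega> = \<Omega>"
  shows "cowen_douglas 1 \<Omega> (\<lambda>x. a *\<^sub>C A (P x) + b *\<^sub>C P x)"
proof -
  let ?R = "\<lambda>x. a *\<^sub>C A (P x) + b *\<^sub>C P x" and ?\<phi> = "linear_fractional a b c d"
  have A: "bounded_clinear A"
    using cd by (simp add: cowen_douglas_def)
  have ker: "op_kernel (op_minus ?R (?\<phi> u)) = op_kernel (op_minus A u)" if "u \<in> \<Omega>" for u
    by (rule linear_fractional_op_eigen[OF A P PM MP z[OF that] D])
  have "(\<Union>w\<in>\<Omega>. op_kernel (op_minus ?R w)) = (\<Union>w\<in>\<Omega>. op_kernel (op_minus A w))"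
    using ker by (subst img[symmetric]) auto
  moreover have "\<Omega> \<subseteq> spectrum ?R \<and> (\<forall>w\<in>\<Omega>. complex_vector.dim (op_kernel (op_minus ?R w)) = 1) \<and>
      (\<forall>w\<in>\<Omega>. range (op_minus ?R w) = UNIV)"
  proof (intro conjI ballI subsetI)
    fix w assume "w \<in> \<Omega>"
    then obtain u where u: "u \<in> \<Omega>" "w = ?\<phi> u"
      using img by blast
    obtain v where v: "v \<noteq> 0" "op_kernel (op_minus A u) = range (\<lambda>c. c *\<^sub>C v)"
      using cowen_douglas_1_kernel[OF cd u(1)] by blast
    then have "v \<in> op_kernel (op_minus ?R w)"
      using range_eqI[of v "\<lambda>c. c *\<^sub>C v" 1] u by (simp add: ker scaleC_one)
    then show "w \<in> spectrum ?R"
      using v(1) eigenvalue_in_spectrum by (auto simp: op_kernel_def)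
    show "complex_vector.dim (op_kernel (op_minus ?R w)) = 1"
      using cd u by (simp add: ker cowen_douglas_def)
    have "\<exists>x. op_minus ?R w x = y" for y
    proof -
      let ?k = "(a * d - b * c) / (c * u + d)"
      have "?k \<noteq> 0"
        using D z[OF u(1)] by simp
      obtain y' where y': "op_minus A u y' = (1 / ?k) *\<^sub>C y"
        using cd u(1) unfolding cowen_douglas_def by (metis UNIV_I imageE)
      \<comment> \<open>The preimage under \<open>A - u\<close> is first sent through
        \<open>c A + d\<close>, which \<open>P\<close> undoes.\<close>
      have "op_minus ?R w (c *\<^sub>C A y' + d *\<^sub>C y') = ?k *\<^sub>C op_minus A u y'"
        unfolding u(2) linear_fractional_op_minus[OF A P PM MP z[OF u(1)]] PM ..
      also have "\<dots> = y"
        unfolding y' scaleC_scaleC using \<open>?k \<noteq> 0\<close> by (simp add: scaleC_one)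
      finally show ?thesis ..
    qed
    then show "range (op_minus ?R w) = UNIV"
      by (metis surjI surj_def)
  qed
  moreover have "bounded_clinear ?R"
    by (intro bounded_clinear_intros bounded_clinear_compose[OF A P] P)
  ultimately show ?thesis
    using cd by (simp add: cowen_douglas_def)
qed

lemma bounded_clinear_block_op:
  assumes "bounded_clinear T0" "bounded_clinear S" "bounded_clinear T1"
  shows "bounded_clinear (block_op T0 S T1)"
  unfolding block_op_def split_beta
  by (intro bounded_clinear_intros bounded_clinear_compose[OF assms(1)] bounded_clinear_compose[OF assms(2)]
      bounded_clinear_compose[OF assms(3)] bounded_clinear_fst bounded_clinear_snd)

text \<open>The off-diagonal entry \<open>S'\<close> is \<open>\<phi>'(T0) S\<close>.\<close>

lemma FB2_linear_fractional:
  fixes T0 :: "'a::{chilbert_space,second_countable_topology} \<Rightarrow> 'a"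
    and T1 :: "'b::{chilbert_space,second_countable_topology} \<Rightarrow> 'b"
  assumes FB: "FB2 \<Omega> T0 S T1"
    and P0: "bounded_clinear P0" "\<And>x. P0 (c *\<^sub>C T0 x + d *\<^sub>C x) = x"
      "\<And>x. c *\<^sub>C T0 (P0 x) + d *\<^sub>C P0 x = x"
    and P1: "bounded_clinear P1" "\<And>x. P1 (c *\<^sub>C T1 x + d *\<^sub>C x) = x"
      "\<And>x. c *\<^sub>C T1 (P1 x) + d *\<^sub>C P1 x = x"
    and z: "\<forall>z\<in>\<Omega>. c * z + d \<noteq> 0" and D: "a * d - b * c \<noteq> 0"
    and img: "linear_fractional a b c d ` \<Omega> = \<Omega>"
  defines "T \<equiv> block_op T0 S T1"
    and "R0 \<equiv> \<lambda>x. a *\<^sub>C T0 (P0 x) + b *\<^sub>C P0 x"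
    and "R1 \<equiv> \<lambda>x. a *\<^sub>C T1 (P1 x) + b *\<^sub>C P1 x"
    and "S' \<equiv> \<lambda>y. (a * d - b * c) *\<^sub>C P0 (P0 (S y))"
    and "P \<equiv> \<lambda>p. (P0 (fst p) - c *\<^sub>C P0 (P0 (S (snd p))), P1 (snd p))"
  shows "FB2 \<Omega> R0 S' R1"
    and "linear_fractional_op a b c d T = block_op R0 S' R1"
    and "bounded_clinear P" "\<And>p. P (c *\<^sub>C T p + d *\<^sub>C p) = p" "\<And>p. c *\<^sub>C T (P p) + d *\<^sub>C P p = p"
    and "block_op R0 S' R1 = (\<lambda>p. a *\<^sub>C T (P p) + b *\<^sub>C P p)"
proof -
  have cd: "cowen_douglas 1 \<Omega> T0" "cowen_douglas 1 \<Omega> T1" and S: "bounded_clinear S"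
    and S0: "S \<noteq> (\<lambda>y. 0)" and ST: "S (T1 y) = T0 (S y)" for y
    using FB by (auto simp: FB2_def fun_eq_iff)
  have T0: "bounded_clinear T0" and T1: "bounded_clinear T1"
    using cd by (auto simp: cowen_douglas_def)
  note lin = bounded_clinear_simps[OF T0] bounded_clinear_simps[OF T1] bounded_clinear_simps[OF S]
    bounded_clinear_simps[OF P0(1)] bounded_clinear_simps[OF P1(1)]
  have TP0: "T0 (P0 x) = P0 (T0 x)" for x
    by (rule commutes_with_inverse[OF T0 P0, symmetric])
  \<comment> \<open>\<open>S\<close> intertwines the inverses too. Hence the off-diagonal entry
    \<open>- c P0 S P1\<close> of the inverse of \<open>c T + d\<close> takes the form
    \<open>- c P0 P0 S\<close> used in \<open>P\<close>.\<close>
  have SP: "S (P1 y) = P0 (S y)" for y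
  proof -
    have "S (P1 y) = P0 (c *\<^sub>C T0 (S (P1 y)) + d *\<^sub>C S (P1 y))"
      by (rule P0(2)[symmetric])
    also have "c *\<^sub>C T0 (S (P1 y)) + d *\<^sub>C S (P1 y) = S (c *\<^sub>C T1 (P1 y) + d *\<^sub>C P1 y)"
      by (simp add: lin ST)
    finally show ?thesis
      unfolding P1(3) .
  qed
  have P0_0: "x = 0" if "P0 x = 0" for x
    using P0(3)[of x] that by (simp add: lin)
  show P: "bounded_clinear P"
    unfolding P_def
    by (intro bounded_clinear_intros bounded_clinear_compose[OF P0(1)] bounded_clinear_compose[OF S]
        bounded_clinear_compose[OF P1(1)] bounded_clinear_fst bounded_clinear_snd)
  show PM: "P (c *\<^sub>C T p + d *\<^sub>C p) = p" for p
  proof (rule prod_eqI)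
    obtain x y where p: "p = (x, y)" by (cases p)
    have "P0 (c *\<^sub>C (T0 x + S y) + d *\<^sub>C x) = x + c *\<^sub>C P0 (S y)"
      using P0(2)[of x] by (simp add: lin scaleC_add_right algebra_simps)
    moreover have "P0 (P0 (S (c *\<^sub>C T1 y + d *\<^sub>C y))) = P0 (S y)"
      using P0(2)[of "S y"] by (simp add: lin ST)
    ultimately show "fst (P (c *\<^sub>C T p + d *\<^sub>C p)) = fst p"
      by (simp add: P_def T_def block_op_def p scaleC_prod_def)
    show "snd (P (c *\<^sub>C T p + d *\<^sub>C p)) = snd p"
      by (simp add: P_def T_def block_op_def p scaleC_prod_def P1)
  qed
  show MP: "c *\<^sub>C T (P p) + d *\<^sub>C P p = p" for p
  proof (rule prod_eqI)
    obtain x y where p: "p = (x, y)" by (cases p)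
    have 1: "c *\<^sub>C T0 (P0 x) = x - d *\<^sub>C P0 x" for x
      using P0(3)[of x] by (simp add: eq_diff_eq)
    show "fst (c *\<^sub>C T (P p) + d *\<^sub>C P p) = fst p"
      using 1[of x] 1[of "P0 (S y)"]
      by (simp add: P_def T_def block_op_def p scaleC_prod_def lin SP scaleC.diff_right scaleC_add_right
          complex_vector.scale_left_commute[of c c] complex_vector.scale_left_commute[of d c])
    show "snd (c *\<^sub>C T (P p) + d *\<^sub>C P p) = snd p"
      by (simp add: P_def T_def block_op_def p scaleC_prod_def P1)
  qed
  show block: "block_op R0 S' R1 = (\<lambda>p. a *\<^sub>C T (P p) + b *\<^sub>C P p)"
  proof
    fix p :: "'a \<times> 'b"
    obtain x y where p: "p = (x, y)" by (cases p)
    \<comment> \<open>The off-diagonal entry of \<phi>(T) is \<open>a v - c (a T0 + b) P0 v\<close>.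
      Expanding \<open>v = (c T0 + d) P0 v\<close> in the first term cancels \<open>T0\<close> and
      leaves the factor \<open>a * d - b * c\<close>.\<close>
    define v where "v = P0 (S y)"
    have v: "v = c *\<^sub>C T0 (P0 v) + d *\<^sub>C P0 v"
      by (rule P0(3)[symmetric])
    have "a *\<^sub>C v = (a * c) *\<^sub>C T0 (P0 v) + (a * d) *\<^sub>C P0 v"
      by (subst v) (simp add: scaleC_add_right scaleC_scaleC)
    then have "S' y = a *\<^sub>C v - c *\<^sub>C (a *\<^sub>C T0 (P0 v) + b *\<^sub>C P0 v)"
      by (simp add: S'_def v_def scaleC_add_right scaleC_scaleC scaleC.diff_left algebra_simps)
    then show "block_op R0 S' R1 p = a *\<^sub>C T (P p) + b *\<^sub>C P p"
      by (simp add: p P_def T_def block_op_def scaleC_prod_def R0_def R1_def lin SP v_def[symmetric]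
          scaleC_add_right scaleC.diff_right scaleC_scaleC algebra_simps)
  qed
  show "linear_fractional_op a b c d T = block_op R0 S' R1"
  proof -
    have "inv (\<lambda>x. c *\<^sub>C T x + d *\<^sub>C x) = P"
      by (rule inv_unique_comp) (auto simp: PM MP)
    then show ?thesis
      unfolding linear_fractional_op_def block by (simp add: comp_def)
  qed
  show "FB2 \<Omega> R0 S' R1"
    unfolding FB2_def
  proof (intro conjI)
    show "cowen_douglas 1 \<Omega> R0"
      unfolding R0_def by (rule cowen_douglas_1_linear_fractional[OF cd(1) P0 bspec[OF z] D img])
    show "cowen_douglas 1 \<Omega> R1"
      unfolding R1_def by (rule cowen_douglas_1_linear_fractional[OF cd(2) P1 bspec[OF z] D img])
    show "bounded_clinear S'"
      unfolding S'_def
      by (intro bounded_clinear_cmult bounded_clinear_compose[OF P0(1)] S)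
    show "S' \<noteq> (\<lambda>y. 0)"
    proof
      assume "S' = (\<lambda>y. 0)"
      then have "S y = 0" for y
        using D P0_0 unfolding S'_def fun_eq_iff by simp
      then show False
        using S0 by auto
    qed
    show "R0 \<circ> S' = S' \<circ> R1"
      by (simp add: fun_eq_iff R0_def R1_def S'_def lin ST SP TP0 scaleC_add_right scaleC_scaleC mult.commute)
  qed
qed

text \<open>At a pole \<open>z\<close> one has \<open>c \<noteq> 0\<close>, since
  \<open>d \<noteq> 0\<close>. So \<open>c (T - z) = c T + d\<close> is invertible, and
  \<open>z\<close> lies outside the spectrum.\<close>

lemma linear_fractional_analytic_on_spectrum:
  assumes P: "bounded_clinear P" "\<And>p. P (c *\<^sub>C T p + d *\<^sub>C p) = p" "\<And>p. c *\<^sub>C T (P p) + d *\<^sub>C P p = p"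
    and T: "bounded_clinear T" and "d \<noteq> 0"
  shows "linear_fractional a b c d analytic_on spectrum T"
proof -
  have "c * z + d \<noteq> 0" if "z \<in> spectrum T" for z
  proof
    assume 0: "c * z + d = 0"
    then have d: "d = - (c * z)"
      by (simp add: eq_neg_iff_add_eq_0 add.commute)
    have M: "c *\<^sub>C op_minus T z p = c *\<^sub>C T p + d *\<^sub>C p" for p
      by (simp add: op_minus_def scaleC.diff_right scaleC_scaleC d scaleC.minus_left)
    have "c \<noteq> 0"
      using 0 \<open>d \<noteq> 0\<close> by auto
    have "(\<lambda>p. c *\<^sub>C P p) \<circ> op_minus T z = id"
      using P(2) by (simp add: fun_eq_iff M flip: bounded_clinear_scaleC[OF P(1)])
    moreover have "op_minus T z \<circ> (\<lambda>p. c *\<^sub>C P p) = id"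
      using P(3) by (simp add: fun_eq_iff M bounded_clinear_scaleC[OF bounded_clinear_op_minus[OF T]])
    moreover have "bounded_clinear (\<lambda>p. c *\<^sub>C P p)"
      using P(1) by (rule bounded_clinear_cmult)
    ultimately show False
      using that unfolding spectrum_def by blast
  qed
  then show ?thesis
    unfolding linear_fractional_def by (intro analytic_intros) auto
qed

section \<open>The slope of the eigenspaces and its invariance\<close>

text \<open>
  The squared tangent of the angle between \<open>ker (T - w)\<close> and the second summand, measured on the
  orthogonal complement of \<open>ker (T0 - w)\<close>.
\<close>

definition kernel_slope ::
    "('a::chilbert_space \<Rightarrow> 'a) \<Rightarrow> ('a \<times> 'b::chilbert_space \<Rightarrow> 'a \<times> 'b) \<Rightarrow> complex \<Rightarrow> real \<Rightarrow> bool" where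
  "kernel_slope T0 T w q \<longleftrightarrow>
     (\<exists>x y. y \<noteq> 0 \<and> T (x, y) = w *\<^sub>C (x, y) \<and> (\<forall>k. T0 k = w *\<^sub>C k \<longrightarrow> cinner x k = 0) \<and>
        (norm x)\<^sup>2 = q * (norm y)\<^sup>2)"

lemma block_op_eigen_iff:
  "block_op T0 S T1 (x, y) = w *\<^sub>C (x, y) \<longleftrightarrow> T0 x + S y = w *\<^sub>C x \<and> T1 y = w *\<^sub>C y"
  by (simp add: block_op_def scaleC_prod_def)

lemma kernel_slope_exists:
  assumes FB: "FB2 \<Omega> T0 S T1" and w: "w \<in> \<Omega>"
  obtains q where "q \<ge> 0" "kernel_slope T0 (block_op T0 S T1) w q"
proof -
  have cd: "cowen_douglas 1 \<Omega> T0" "cowen_douglas 1 \<Omega> T1" and T0: "bounded_clinear T0"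
    using FB by (auto simp: FB2_def cowen_douglas_def)
  obtain y where y: "y \<noteq> 0" "T1 y = w *\<^sub>C y"
    using cowen_douglas_1_kernel[OF cd(2) w] by (metis mem_op_kernel_op_minus rangeI scaleC_one)
  obtain v where v: "v \<noteq> 0" "op_kernel (op_minus T0 w) = range (\<lambda>c. c *\<^sub>C v)"
    using cowen_douglas_1_kernel[OF cd(1) w] by blast
  have Tv: "T0 v = w *\<^sub>C v"
    unfolding mem_op_kernel_op_minus[symmetric] v(2) by (metis rangeI scaleC_one)
  obtain x0 where x0: "op_minus T0 w x0 = - S y"
    using cd(1) w unfolding cowen_douglas_def by (metis UNIV_I imageE)
  \<comment> \<open>Subtracting the projection onto \<open>ker (T0 - w)\<close> keeps the equation
    and gives the orthogonality.\<close>
  define x where "x = x0 - (cinner x0 v / cinner v v) *\<^sub>C v"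
  have "T0 x + S y = w *\<^sub>C x"
    using x0 by (simp add: x_def bounded_clinear_simps[OF T0] Tv op_minus_def scaleC.diff_right
        scaleC_scaleC mult.commute algebra_simps eq_neg_iff_add_eq_0)
  moreover have "cinner x k = 0" if "T0 k = w *\<^sub>C k" for k
  proof -
    have "k \<in> range (\<lambda>c. c *\<^sub>C v)"
      using that by (simp add: mem_op_kernel_op_minus flip: v(2))
    then obtain c where "k = c *\<^sub>C v"
      by blast
    then show ?thesis
      using v(1) by (simp add: x_def cinner.diff_left cinner_scaleC_left cinner_scaleC_right)
  qed
  moreover have "(norm x)\<^sup>2 = (norm x)\<^sup>2 / (norm y)\<^sup>2 * (norm y)\<^sup>2"
    using y(1) by simp
  ultimately have "kernel_slope T0 (block_op T0 S T1) w ((norm x)\<^sup>2 / (norm y)\<^sup>2)"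
    unfolding kernel_slope_def block_op_eigen_iff using y by blast
  then show thesis
    by (intro that[of "(norm x)\<^sup>2 / (norm y)\<^sup>2"]) simp_all
qed

text \<open>This makes the relation \<open>kernel_slope\<close> single-valued. The second component
  determines the first, because two candidates differ by an element of \<open>ker (T0 - w)\<close>
  that is orthogonal to \<open>ker (T0 - w)\<close>.\<close>

lemma kernel_slope_eq:
  assumes FB: "FB2 \<Omega> T0 S T1" and w: "w \<in> \<Omega>" and q: "kernel_slope T0 (block_op T0 S T1) w q"
    and xy: "block_op T0 S T1 (x, y) = w *\<^sub>C (x, y)" "\<And>k. T0 k = w *\<^sub>C k \<Longrightarrow> cinner x k = 0"
  shows "(norm x)\<^sup>2 = q * (norm y)\<^sup>2"
proof -
  have cd: "cowen_douglas 1 \<Omega> T1" and T0: "bounded_clinear T0" and S: "bounded_clinear S"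
    using FB by (auto simp: FB2_def cowen_douglas_def)
  obtain u v where v: "v \<noteq> 0" "block_op T0 S T1 (u, v) = w *\<^sub>C (u, v)"
      "\<And>k. T0 k = w *\<^sub>C k \<Longrightarrow> cinner u k = 0" "(norm u)\<^sup>2 = q * (norm v)\<^sup>2"
    using q unfolding kernel_slope_def by blast
  obtain c where c: "y = c *\<^sub>C v"
    using cowen_douglas_1_eigenvector_multiple[OF cd w, of v y] v xy by (auto simp: block_op_eigen_iff)
  have "T0 u = w *\<^sub>C u - S v" "T0 x = w *\<^sub>C x - c *\<^sub>C S v"
    using v(2) xy(1) by (simp_all add: block_op_eigen_iff c bounded_clinear_simps[OF S] eq_diff_eq)
  then have "T0 (x - c *\<^sub>C u) = w *\<^sub>C (x - c *\<^sub>C u)"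
    by (simp add: bounded_clinear_simps[OF T0] scaleC.diff_right complex_vector.scale_left_commute[of w c])
  then have "cinner (x - c *\<^sub>C u) (x - c *\<^sub>C u) = 0"
    using v(3) xy(2) by (simp add: cinner.diff_left cinner_scaleC_left)
  then have "x = c *\<^sub>C u"
    by simp
  then show ?thesis
    using v(4) by (simp add: c norm_scaleC power_mult_distrib)
qed

lemma bounded_clinear_inv_isometry:
  assumes U: "bounded_clinear U" "bij U" and iso: "\<And>x y. cinner (U x) (U y) = cinner x y"
  shows "bounded_clinear (inv U)"
proof -
  have UQ: "U (inv U y) = y" for y
    using U(2) by (simp add: bij_is_surj surj_f_inv_f)
  have norm: "norm (U x) = norm x" for x
  proof -
    have "(norm (U x))\<^sup>2 = (norm x)\<^sup>2"
      using iso[of x x] unfolding cinner_self of_real_eq_iff .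
    then show ?thesis
      by (simp add: power2_eq_iff_nonneg)
  qed
  have inj: "x = y" if "U x = U y" for x y
    using U(2) that by (simp add: bij_is_inj inj_eq)
  have "inv U (x + y) = inv U x + inv U y" for x y
    by (rule inj) (simp add: UQ bounded_clinear_simps[OF U(1)])
  moreover have "inv U (c *\<^sub>C x) = c *\<^sub>C inv U x" for c x
    by (rule inj) (simp add: UQ bounded_clinear_simps[OF U(1)])
  moreover have "norm (inv U x) \<le> norm x" for x
    using norm[of "inv U x"] by (simp add: UQ)
  ultimately show ?thesis
    unfolding bounded_clinear_def
    by (intro conjI bounded_linear_intro[of _ 1]) (auto simp: scaleR_scaleC)
qed

text \<open>Eigenvectors of \<open>T\<close> for \<open>w\<close> are those of the intertwined
  operator for \<open>w'\<close>, and \<open>U\<close> carries them to eigenvectors of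
  \<open>T\<close> for \<open>w'\<close>. Being unitary and block diagonal, \<open>U\<close>
  preserves the norms of both components and the orthogonality to the kernel, hence the ratio
  \<open>q\<close>.\<close>

lemma kernel_slope_transport:
  fixes T0 :: "'a::{chilbert_space,second_countable_topology} \<Rightarrow> 'a"
    and T1 :: "'b::{chilbert_space,second_countable_topology} \<Rightarrow> 'b"
    and U :: "'a \<times> 'b \<Rightarrow> 'a \<times> 'b"
  assumes T: "FB2 \<Omega> T0 S T1" and R: "FB2 \<Omega> R0 S' R1"
    and U: "bounded_clinear U" "bij U" "\<And>p q. cinner (U p) (U q) = cinner p q"
      "U \<circ> block_op R0 S' R1 = block_op T0 S T1 \<circ> U"
    and ker: "\<And>p. block_op R0 S' R1 p = w' *\<^sub>C p \<longleftrightarrow> block_op T0 S T1 p = w *\<^sub>C p"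
    and q: "kernel_slope T0 (block_op T0 S T1) w q"
  shows "kernel_slope T0 (block_op T0 S T1) w' q"
proof -
  let ?T = "block_op T0 S T1" and ?R = "block_op R0 S' R1"
  have T01: "bounded_clinear S" "bounded_clinear T1"
    using T by (auto simp: FB2_def cowen_douglas_def)
  define Q where "Q = inv U"
  have Q: "bounded_clinear Q"
    unfolding Q_def by (rule bounded_clinear_inv_isometry[OF U(1-3)])
  have UQ: "U (Q p) = p" and QU: "Q (U p) = p" for p
    using U(2) by (simp_all add: Q_def bij_is_surj surj_f_inv_f bij_is_inj)
  have UR: "U (?R p) = ?T (U p)" for p
    using U(4) by (metis comp_apply)
  have QT: "Q (?T p) = ?R (Q p)" for p
    using UR[of "Q p"] by (metis UQ QU)
  have left: "maps_left_summand U" "maps_left_summand Q"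
    using FB2_intertwiner_maps_left_summand[OF T R U(1) UR Q QT QU UQ] by auto
  have eig: "?T (U p) = w' *\<^sub>C U p \<longleftrightarrow> ?T p = w *\<^sub>C p" for p
  proof -
    have "?T (U p) = w' *\<^sub>C U p \<longleftrightarrow> U (?R p) = U (w' *\<^sub>C p)"
      by (simp add: UR bounded_clinear_scaleC[OF U(1)])
    also have "\<dots> \<longleftrightarrow> ?R p = w' *\<^sub>C p"
      using U(2) by (simp add: bij_is_inj inj_eq)
    finally show ?thesis
      by (simp add: ker)
  qed
  \<comment> \<open>The adjoint of \<open>U\<close> is \<open>Q\<close>; as \<open>Q\<close>
    preserves the left summand, \<open>U\<close> preserves its orthogonal complement.\<close>
  have right: "fst (U (0, y)) = 0" for y
  proof -
    let ?x = "fst (U (0, y))"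
    have "U (0, y) \<bullet> (?x, 0) = (0, y) \<bullet> Q (?x, 0)"
      unfolding inner_eq_Re_cinner by (metis U(3) UQ)
    also have "\<dots> = 0"
      using left(2) by (cases "Q (?x, 0)") (simp add: maps_left_summand_def, metis snd_conv inner_zero_right)
    finally show ?thesis
      by (cases "U (0, y)") simp
  qed
  obtain x y where xy: "y \<noteq> 0" "?T (x, y) = w *\<^sub>C (x, y)"
      "\<And>k. T0 k = w *\<^sub>C k \<Longrightarrow> cinner x k = 0" "(norm x)\<^sup>2 = q * (norm y)\<^sup>2"
    using q unfolding kernel_slope_def by blast
  obtain x' where x': "U (x, 0) = (x', 0)"
    using left(1) unfolding maps_left_summand_def by (metis prod.collapse)
  obtain y' where y': "U (0, y) = (0, y')"
    using right[of y] by (metis prod.collapse)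
  have norms: "norm x' = norm x" "norm y' = norm y"
    using U(3)[of "(x, 0)" "(x, 0)"] U(3)[of "(0, y)" "(0, y)"]
    by (simp_all add: x' y' cinner_prod_def cinner_self power2_eq_iff_nonneg flip: of_real_power)
  have "U (x, y) = U (x, 0) + U (0, y)"
    by (subst bounded_clinear_add[OF U(1), symmetric]) simp
  then have "?T (x', y') = w' *\<^sub>C (x', y')"
    using eig[of "(x, y)"] xy(2) by (simp add: x' y')
  moreover have "cinner x' k = 0" if k: "T0 k = w' *\<^sub>C k" for k
  proof -
    obtain k' where k': "Q (k, 0) = (k', 0)"
      using left(2) unfolding maps_left_summand_def by (metis prod.collapse)
    have "?T (k, 0) = w' *\<^sub>C (k, 0)"
      using k by (simp add: block_op_eigen_iff bounded_clinear_zero[OF T01(1)] bounded_clinear_zero[OF T01(2)])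
    then have "?T (k', 0) = w *\<^sub>C (k', 0)"
      using eig[of "(k', 0)"] UQ[of "(k, 0)"] by (simp add: k')
    then have "T0 k' = w *\<^sub>C k'"
      by (simp add: block_op_eigen_iff bounded_clinear_zero[OF T01(1)])
    then have "cinner x k' = 0"
      by (rule xy(3))
    moreover have "cinner (x', 0::'b) (k, 0) = cinner (x, 0::'b) (k', 0)"
      by (metis U(3) UQ x' k')
    ultimately show ?thesis
      by (simp add: cinner_prod_def)
  qed
  moreover have "y' \<noteq> 0" "(norm x')\<^sup>2 = q * (norm y')\<^sup>2"
    using norms xy(1,4) by auto
  ultimately show ?thesis
    unfolding kernel_slope_def by blast
qed

text \<open>
  The disc automorphism moving \<open>w0\<close> to a nearby point is close to the identity, so its pole lies
  outside the spectrum although nothing is known about the size of the latter.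
\<close>

lemma kernel_slope_locally_constant:
  fixes T0 :: "'a::{chilbert_space,second_countable_topology} \<Rightarrow> 'a"
    and T1 :: "'b::{chilbert_space,second_countable_topology} \<Rightarrow> 'b"
  assumes FB: "FB2 (ball 0 1) T0 S T1" and hom: "homogeneous (block_op T0 S T1)"
    and w0: "w0 \<in> ball 0 1" and q: "kernel_slope T0 (block_op T0 S T1) w0 q"
  obtains r where "r > 0" "ball w0 r \<subseteq> ball 0 1"
    "\<And>w. w \<in> ball w0 r \<Longrightarrow> kernel_slope T0 (block_op T0 S T1) w q"
proof -
  let ?T = "block_op T0 S T1"
  have T: "bounded_clinear T0" "bounded_clinear T1"
    using FB by (auto simp: FB2_def cowen_douglas_def)
  obtain K0 where K0: "K0 > 0" "\<And>x. norm (T0 x) \<le> K0 * norm x"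
    using bounded_clinear_bound[OF T(1)] by blast
  obtain K1 where K1: "K1 > 0" "\<And>x. norm (T1 x) \<le> K1 * norm x"
    using bounded_clinear_bound[OF T(2)] by blast
  define K where "K = max K0 K1"
  have K: "K \<ge> 0" "norm (T0 x) \<le> K * norm x" "norm (T1 y) \<le> K * norm y" for x y
    using K0(1) order_trans[OF K0(2) mult_right_mono[of K0 K]] order_trans[OF K1(2) mult_right_mono[of K1 K]]
    by (simp_all add: K_def)
  \<comment> \<open>The points \<open>w\<close> for which the automorphism chosen below satisfies
    \<open>|b| K < |a|\<close>, which makes \<open>cnj b T0 + cnj a\<close> and
    \<open>cnj b T1 + cnj a\<close> invertible. At \<open>w0\<close> the left side is 0.\<close>
  define V where "V = ball 0 1 \<inter> {w. cmod (w - w0) * K < cmod (1 - w * cnj w0)}"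
  have pos: "1 - (cmod w0)\<^sup>2 > 0"
    using w0 by (simp add: abs_square_less_1)
  have w0': "1 - w0 * cnj w0 = of_real (1 - (cmod w0)\<^sup>2)"
    using complex_norm_square[of w0] by simp
  have w0_nz: "1 - w0 * cnj w0 \<noteq> 0"
    unfolding w0' of_real_eq_0_iff using pos by simp
  have "open V"
    unfolding V_def by (intro open_Int open_ball open_Collect_less continuous_intros)
  moreover have "w0 \<in> V"
    using w0 w0_nz by (simp add: V_def)
  ultimately obtain r where r: "r > 0" "ball w0 r \<subseteq> V"
    using open_contains_ball by blast
  have "kernel_slope T0 ?T w q" if "w \<in> ball w0 r" for w
  proof -
    have w: "cmod w < 1" "cmod (w - w0) * K < cmod (1 - w * cnj w0)"
      using that r(2) by (auto simp: V_def)
    \<comment> \<open>Coefficients of \<open>z \<mapsto> (z - w0) / (1 - cnj w0 * z)\<close>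
      followed by \<open>u \<mapsto> (u + w) / (1 + cnj w * u)\<close>: the composition sends
      \<open>w0\<close> to \<open>w\<close> by way of 0 and is the identity when
      \<open>w = w0\<close>.\<close>
    define a where "a = 1 - w * cnj w0"
    define b where "b = w - w0"
    have "(cmod a)\<^sup>2 - (cmod b)\<^sup>2 = (1 - (cmod w)\<^sup>2) * (1 - (cmod w0)\<^sup>2)"
      unfolding cmod_power2 a_def b_def by (simp add: power2_eq_square algebra_simps)
    also have "\<dots> > 0"
      using pos w(1) by (intro mult_pos_pos) (simp_all add: abs_square_less_1)
    finally have ab: "cmod b < cmod a"
      by (simp add: power2_less_imp_less)
    have small: "cmod (cnj b) * K < cmod (cnj a)"
      using w(2) unfolding complex_mod_cnj by (simp add: a_def b_def)
    obtain P0 where P0: "bounded_clinear P0" "\<And>x. P0 (cnj b *\<^sub>C T0 x + cnj a *\<^sub>C x) = x"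
        "\<And>x. cnj b *\<^sub>C T0 (P0 x) + cnj a *\<^sub>C P0 x = x"
      using affine_op_inverse[OF T(1) K(2) K(1) small] by blast
    obtain P1 where P1: "bounded_clinear P1" "\<And>x. P1 (cnj b *\<^sub>C T1 x + cnj a *\<^sub>C x) = x"
        "\<And>x. cnj b *\<^sub>C T1 (P1 x) + cnj a *\<^sub>C P1 x = x"
      using affine_op_inverse[OF T(2) K(3) K(1) small] by blast
    have nz: "\<forall>z\<in>ball 0 1. cnj b * z + cnj a \<noteq> 0"
      using Moebius_denominator_nonzero[OF ab] by simp
    have D: "a * cnj a - b * cnj b \<noteq> 0"
      using ab by (simp add: complex_norm_square[symmetric] flip: of_real_power of_real_diff)
    note img = Moebius_image_disc[OF ab]
    note R = FB2_linear_fractional[OF FB P0 P1 nz D img]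
    have Tb: "bounded_clinear ?T"
      using hom by (simp add: homogeneous_def)
    have "cnj a \<noteq> 0"
      using ab by auto
    have analytic: "linear_fractional a b (cnj b) (cnj a) analytic_on spectrum ?T"
      by (rule linear_fractional_analytic_on_spectrum[OF R(3-5) Tb \<open>cnj a \<noteq> 0\<close>])
    have "unitarily_equivalent (linear_fractional_op a b (cnj b) (cnj a) ?T) ?T"
      using hom analytic D img unfolding homogeneous_def by blast
    then obtain U where U: "bounded_clinear U" "bij U" "\<And>p q. cinner (U p) (U q) = cinner p q"
        "U \<circ> linear_fractional_op a b (cnj b) (cnj a) ?T = ?T \<circ> U"
      unfolding unitarily_equivalent_def by blast
    have \<phi>: "linear_fractional a b (cnj b) (cnj a) w0 = w"
    proof -
      have num: "a * w0 + b = w * (1 - w0 * cnj w0)" and den: "cnj b * w0 + cnj a = 1 - w0 * cnj w0"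
        by (simp_all add: a_def b_def algebra_simps)
      show ?thesis
        unfolding linear_fractional_def num den using w0_nz by simp
    qed
    note ker = linear_fractional_op_eigen[OF Tb R(3-5) bspec[OF nz w0] D, unfolded \<phi>]
    show ?thesis
    proof (rule kernel_slope_transport[OF FB R(1) U(1-3) _ _ q])
      show "U \<circ> block_op (\<lambda>x. a *\<^sub>C T0 (P0 x) + b *\<^sub>C P0 x)
           (\<lambda>y. (a * cnj a - b * cnj b) *\<^sub>C P0 (P0 (S y)))
           (\<lambda>x. a *\<^sub>C T1 (P1 x) + b *\<^sub>C P1 x) = ?T \<circ> U"
        using U(4) unfolding R(2) .
      show "block_op (\<lambda>x. a *\<^sub>C T0 (P0 x) + b *\<^sub>C P0 x)
           (\<lambda>y. (a * cnj a - b * cnj b) *\<^sub>C P0 (P0 (S y)))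
           (\<lambda>x. a *\<^sub>C T1 (P1 x) + b *\<^sub>C P1 x) p = w *\<^sub>C p \<longleftrightarrow> ?T p = w0 *\<^sub>C p" for p
        using arg_cong[OF ker, of "\<lambda>X. p \<in> X"] unfolding R(6) mem_op_kernel_op_minus .
    qed
  qed
  moreover have "ball w0 r \<subseteq> ball 0 1"
    using r(2) by (auto simp: V_def)
  ultimately show thesis
    using r(1) that by blast
qed


section \<open>Wirtinger derivatives and curvature\<close>

text \<open>Real differentiability is built in, because \<open>d_w\<close> and \<open>d_wbar\<close>
  carry no information where the Frechet derivative does not exist.\<close>

definition has_wirtinger :: "(complex \<Rightarrow> complex) \<Rightarrow> complex \<Rightarrow> complex \<Rightarrow> complex \<Rightarrow> bool" where
  "has_wirtinger f p q z \<longleftrightarrow> (f has_derivative (\<lambda>h. p * h + q * cnj h)) (at z)"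

lemma has_wirtinger_imp:
  assumes "has_wirtinger f p q z"
  shows d_w_eq: "d_w f z = p" and d_wbar_eq: "d_wbar f z = q"
proof -
  have "frechet_derivative f (at z) = (\<lambda>h. p * h + q * cnj h)"
    using assms unfolding has_wirtinger_def by (rule frechet_derivative_at[symmetric])
  then show "d_w f z = p" "d_wbar f z = q"
    by (simp_all add: d_w_def d_wbar_def algebra_simps)
qed

lemma has_wirtinger_differentiable: "has_wirtinger f p q z \<Longrightarrow> f differentiable (at z)"
  unfolding has_wirtinger_def differentiable_def by blast

lemma differentiable_has_wirtinger:
  assumes "f differentiable (at z)"
  shows "has_wirtinger f (d_w f z) (d_wbar f z) z"
proof -
  let ?D = "frechet_derivative f (at z)"
  have D: "(f has_derivative ?D) (at z)"
    using assms frechet_derivative_works by blast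
  then interpret linear ?D
    by (rule has_derivative_linear)
  have "?D h = d_w f z * h + d_wbar f z * cnj h" for h
  proof -
    have "?D h = ?D (Re h *\<^sub>R 1 + Im h *\<^sub>R \<i>)"
      by (rule arg_cong[of _ _ ?D]) (simp add: complex_eq_iff)
    also have "\<dots> = of_real (Re h) * ?D 1 + of_real (Im h) * ?D \<i>"
      by (simp only: add scale) (simp only: scaleR_conv_of_real)
    also have "\<dots> = d_w f z * h + d_wbar f z * cnj h"
    proof -
      have h: "h = of_real (Re h) + \<i> * of_real (Im h)" "cnj h = of_real (Re h) - \<i> * of_real (Im h)"
        by (simp_all add: complex_eq_iff)
      show ?thesis
        unfolding d_w_def d_wbar_def by (subst (3) h(1), subst h(2)) (simp add: field_simps)
    qed
    finally show ?thesis .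
  qed
  then have "?D = (\<lambda>h. d_w f z * h + d_wbar f z * cnj h)"
    by (rule ext)
  then show ?thesis
    using D unfolding has_wirtinger_def by metis
qed

lemma has_wirtinger_add:
  "has_wirtinger f p q z \<Longrightarrow> has_wirtinger g r s z \<Longrightarrow> has_wirtinger (\<lambda>z. f z + g z) (p + r) (q + s) z"
  unfolding has_wirtinger_def
  by (rule has_derivative_eq_rhs, erule (1) has_derivative_add) (simp add: fun_eq_iff algebra_simps)

lemma has_wirtinger_diff:
  "has_wirtinger f p q z \<Longrightarrow> has_wirtinger g r s z \<Longrightarrow> has_wirtinger (\<lambda>z. f z - g z) (p - r) (q - s) z"
  unfolding has_wirtinger_def
  by (rule has_derivative_eq_rhs, erule (1) has_derivative_diff) (simp add: fun_eq_iff algebra_simps)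

lemma has_wirtinger_mult:
  "has_wirtinger f p q z \<Longrightarrow> has_wirtinger g r s z \<Longrightarrow>
    has_wirtinger (\<lambda>z. f z * g z) (p * g z + f z * r) (q * g z + f z * s) z"
  unfolding has_wirtinger_def
  by (rule has_derivative_eq_rhs, erule (1) has_derivative_mult) (simp add: fun_eq_iff algebra_simps)

lemma has_wirtinger_const: "has_wirtinger (\<lambda>z. c) 0 0 z"
  unfolding has_wirtinger_def by simp

lemma has_wirtinger_cnj: "has_wirtinger f p q z \<Longrightarrow> has_wirtinger (\<lambda>z. cnj (f z)) (cnj q) (cnj p) z"
  unfolding has_wirtinger_def
  by (rule has_derivative_eq_rhs, erule has_derivative_cnj) (simp add: fun_eq_iff algebra_simps)

lemma has_wirtinger_field_derivative:
  "(f has_field_derivative p) (at z) \<Longrightarrow> has_wirtinger f p 0 z"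
  unfolding has_wirtinger_def has_field_derivative_def by simp

text \<open>The second slot is conjugate linear, so a holomorphic function there contributes only to
  the derivative in the conjugate variable.\<close>

lemma has_wirtinger_cinner:
  assumes "(\<beta> has_derivative (\<lambda>h. h *\<^sub>C u)) (at z)" "(\<gamma> has_derivative (\<lambda>h. h *\<^sub>C v)) (at z)"
  shows "has_wirtinger (\<lambda>z. cinner (\<beta> z) (\<gamma> z)) (cinner u (\<gamma> z)) (cinner (\<beta> z) v) z"
  using cinner.FDERIV[OF assms] unfolding has_wirtinger_def
  by (rule has_derivative_eq_rhs)
    (simp add: fun_eq_iff cinner_scaleC_left cinner_scaleC_right algebra_simps)

lemma differentiable_cinner:
  assumes "vholomorphic_on \<beta> V" "vholomorphic_on \<gamma> V" "open V" "z \<in> V"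
  shows "(\<lambda>z. cinner (\<beta> z) (\<gamma> z)) differentiable (at z)"
proof -
  obtain \<beta>' \<gamma>' where "(\<beta> has_derivative (\<lambda>h. h *\<^sub>C \<beta>')) (at z)" "(\<gamma> has_derivative (\<lambda>h. h *\<^sub>C \<gamma>')) (at z)"
    using vholomorphic_onD[OF assms(1,3)] vholomorphic_onD[OF assms(2,3)] assms(4) by metis
  then show ?thesis
    using has_wirtinger_cinner has_wirtinger_differentiable by blast
qed

lemma d_wbar_add:
  assumes "f differentiable (at z)" "g differentiable (at z)"
  shows "d_wbar (\<lambda>z. f z + g z) z = d_wbar f z + d_wbar g z"
  by (rule d_wbar_eq[OF has_wirtinger_add[OF assms[THEN differentiable_has_wirtinger]]])

lemma frechet_derivative_cong_open:
  assumes "open V" "z \<in> V" and eq: "\<And>u. u \<in> V \<Longrightarrow> f u = g u"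
  shows "frechet_derivative f (at z) = frechet_derivative g (at z)"
proof -
  have "(f has_derivative D) (at z) \<longleftrightarrow> (g has_derivative D) (at z)" for D
    by (rule iffI; erule has_derivative_transform_within_open[OF _ assms(1,2)]; simp add: eq)
  then show ?thesis
    by (simp add: frechet_derivative_def)
qed

lemma d_w_cong:
  assumes "open V" "z \<in> V" "\<And>u. u \<in> V \<Longrightarrow> f u = g u"
  shows "d_w f z = d_w g z"
  using frechet_derivative_cong_open[of V z f g] assms by (simp add: d_w_def)

lemma d_wbar_cong:
  assumes "open V" "z \<in> V" "\<And>u. u \<in> V \<Longrightarrow> f u = g u"
  shows "d_wbar f z = d_wbar g z"
  using frechet_derivative_cong_open[of V z f g] assms by (simp add: d_wbar_def)

text \<open>Removes the logarithm: under the outer derivative remains a quotient of inner products,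
  the form in which the logarithmic derivative of the Gram determinant splits.\<close>

lemma section_curvature_eq:
  assumes deriv: "\<And>z. z \<in> V \<Longrightarrow> (s has_derivative (\<lambda>h. h *\<^sub>C s' z)) (at z)"
    and V: "open V" "w \<in> V" and nz: "\<And>z. z \<in> V \<Longrightarrow> s z \<noteq> 0"
  shows "section_curvature s w = - d_wbar (\<lambda>z. cinner (s' z) (s z) / cinner (s z) (s z)) w"
proof -
  have log: "d_w (\<lambda>u. complex_of_real (ln ((norm (s u))\<^sup>2))) z = cinner (s' z) (s z) / cinner (s z) (s z)"
    if z: "z \<in> V" for z
  proof -
    let ?N = "\<lambda>h. cinner (s' z) (s z) * h + cinner (s z) (s' z) * cnj h"
    have "((\<lambda>u. cinner (s u) (s u)) has_derivative ?N) (at z)"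
      using has_wirtinger_cinner[OF deriv[OF z] deriv[OF z]] by (simp add: has_wirtinger_def)
    then have "((\<lambda>u. Re (cinner (s u) (s u))) has_derivative (\<lambda>h. Re (?N h))) (at z)"
      by (rule has_derivative_Re)
    then have "((\<lambda>u. (norm (s u))\<^sup>2) has_derivative (\<lambda>h. Re (?N h))) (at z)"
      by (simp add: cinner_self)
    then have "((\<lambda>u. ln ((norm (s u))\<^sup>2)) has_derivative (\<lambda>h. Re (?N h) * inverse ((norm (s z))\<^sup>2))) (at z)"
      using nz[OF z] by (intro has_derivative_ln) auto
    then have "((\<lambda>u. complex_of_real (ln ((norm (s u))\<^sup>2))) has_derivative
        (\<lambda>h. of_real (Re (?N h) * inverse ((norm (s z))\<^sup>2)))) (at z)"
      by (rule has_derivative_of_real)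
    moreover have "of_real (Re (?N h) * inverse ((norm (s z))\<^sup>2))
        = cinner (s' z) (s z) / cinner (s z) (s z) * h + cinner (s z) (s' z) / cinner (s z) (s z) * cnj h" for h
    proof -
      have "?N h = cnj (?N h)"
        by (subst (1 2) cinner_commute) (simp add: add.commute)
      then have "of_real (Re (?N h)) = ?N h"
        by (metis complex_cnj_complex_of_real complex_cnj_cnj Reals_cnj_iff of_real_Re)
      then show ?thesis
        by (simp only: of_real_mult of_real_inverse cinner_self[symmetric])
          (simp add: divide_inverse algebra_simps)
    qed
    ultimately have "has_wirtinger (\<lambda>u. complex_of_real (ln ((norm (s u))\<^sup>2)))
        (cinner (s' z) (s z) / cinner (s z) (s z)) (cinner (s z) (s' z) / cinner (s z) (s z)) z"
      unfolding has_wirtinger_def by simp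
    then show ?thesis
      by (rule d_w_eq)
  qed
  show ?thesis
    unfolding section_curvature_def by (rule arg_cong[OF d_wbar_cong[OF V log]])
qed

lemma matrix_inv_2:
  fixes A :: "complex^2^2"
  assumes D: "A$1$1 * A$2$2 - A$1$2 * A$2$1 = D" "D \<noteq> 0"
  shows "matrix_inv A $ 1 $ 1 = A$2$2 / D" "matrix_inv A $ 1 $ 2 = - A$1$2 / D"
    "matrix_inv A $ 2 $ 1 = - A$2$1 / D" "matrix_inv A $ 2 $ 2 = A$1$1 / D"
proof -
  have "det A \<noteq> 0"
    using D by (simp add: det_2)
  then have "invertible A"
    by (simp add: invertible_det_nz)
  then have "matrix_inv A ** A = mat 1"
    unfolding invertible_def matrix_inv_def by (rule someI2_ex) blast
  then have e: "(\<Sum>k\<in>UNIV. matrix_inv A $ i $ k * A $ k $ j) = (if i = j then 1 else 0)" for i j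
    by (simp add: matrix_matrix_mult_def mat_def vec_eq_iff)
  let ?B = "matrix_inv A"
  have e': "?B$i$1 * A$1$j + ?B$i$2 * A$2$j = (if i = j then 1 else 0)" for i j
    using e[of i j] by (simp add: sum_2)
  have "?B$i$1 * D = (if i = 1 then 1 else 0) * A$2$2 - (if i = 2 then 1 else 0) * A$2$1" for i
    unfolding D(1)[symmetric] e'[symmetric] by (simp add: algebra_simps)
  moreover have "?B$i$2 * D = (if i = 2 then 1 else 0) * A$1$1 - (if i = 1 then 1 else 0) * A$1$2" for i
    unfolding D(1)[symmetric] e'[symmetric] by (simp add: algebra_simps)
  ultimately show "?B $ 1 $ 1 = A$2$2 / D" "?B $ 1 $ 2 = - A$1$2 / D"
    "?B $ 2 $ 1 = - A$2$1 / D" "?B $ 2 $ 2 = A$1$1 / D"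
    unfolding nonzero_eq_divide_eq[OF D(2)] by simp_all
qed

text \<open>The trace of \<open>h\<^sup>-\<^sup>1 \<partial>h\<close> is the logarithmic derivative of \<open>det h\<close>, and the factor
  \<open>\<Delta> * cnj \<Delta>\<close> does not contribute to the curvature.\<close>

lemma trace_frame_curvature:
  fixes \<gamma> :: "2 \<Rightarrow> complex \<Rightarrow> 'c::chilbert_space" and s0 :: "complex \<Rightarrow> 'a::chilbert_space"
    and s1 :: "complex \<Rightarrow> 'b::chilbert_space"
  assumes V: "open V" "w \<in> V" and \<gamma>: "\<And>i. vholomorphic_on (\<gamma> i) V"
    and s: "vholomorphic_on s0 V" "vholomorphic_on s1 V"
    and nz: "\<And>z. z \<in> V \<Longrightarrow> s0 z \<noteq> 0" "\<And>z. z \<in> V \<Longrightarrow> s1 z \<noteq> 0"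
    and \<Delta>: "\<Delta> holomorphic_on V" "\<And>z. z \<in> V \<Longrightarrow> \<Delta> z \<noteq> 0" and C: "C \<noteq> 0"
    and det: "\<And>z. z \<in> V \<Longrightarrow>
      cinner (\<gamma> 1 z) (\<gamma> 1 z) * cinner (\<gamma> 2 z) (\<gamma> 2 z) - cinner (\<gamma> 2 z) (\<gamma> 1 z) * cinner (\<gamma> 1 z) (\<gamma> 2 z)
      = C * (cinner (s0 z) (s0 z) * cinner (s1 z) (s1 z) * (\<Delta> z * cnj (\<Delta> z)))"
  shows "trace (frame_curvature \<gamma> w) = section_curvature s0 w + section_curvature s1 w"
proof -
  have "\<exists>\<gamma>'. \<forall>z\<in>V. (\<gamma> i has_derivative (\<lambda>h. h *\<^sub>C \<gamma>' z)) (at z)" for i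
    using vholomorphic_onD[OF \<gamma> V(1)] by metis
  then obtain \<gamma>' where d: "\<And>i z. z \<in> V \<Longrightarrow> (\<gamma> i has_derivative (\<lambda>h. h *\<^sub>C \<gamma>' i z)) (at z)"
    by metis
  obtain s0' where d0: "\<And>z. z \<in> V \<Longrightarrow> (s0 has_derivative (\<lambda>h. h *\<^sub>C s0' z)) (at z)"
    using vholomorphic_onD[OF s(1) V(1)] by metis
  obtain s1' where d1: "\<And>z. z \<in> V \<Longrightarrow> (s1 has_derivative (\<lambda>h. h *\<^sub>C s1' z)) (at z)"
    using vholomorphic_onD[OF s(2) V(1)] by metis
  define h where "h = (\<lambda>i j z. cinner (\<gamma> j z) (\<gamma> i z))"
  define k where "k = (\<lambda>i j z. cinner (\<gamma>' j z) (\<gamma> i z))"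
  define L0 where "L0 = (\<lambda>z. cinner (s0' z) (s0 z) / cinner (s0 z) (s0 z))"
  define L1 where "L1 = (\<lambda>z. cinner (s1' z) (s1 z) / cinner (s1 z) (s1 z))"
  define D where "D = (\<lambda>z. h 1 1 z * h 2 2 z - h 1 2 z * h 2 1 z)"
  have D: "D z = C * (cinner (s0 z) (s0 z) * cinner (s1 z) (s1 z) * (\<Delta> z * cnj (\<Delta> z)))" if "z \<in> V" for z
    using det[OF that] by (simp add: D_def h_def)
  have D_nz: "D z \<noteq> 0" if "z \<in> V" for z
    using that by (simp add: D C nz \<Delta>)
  have dh: "d_w (h i j) z = k i j z" if "z \<in> V" for i j z
    unfolding h_def k_def by (rule d_w_eq[OF has_wirtinger_cinner[OF d[OF that] d[OF that]]])
  have diff_h: "h i j differentiable (at w)" for i j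
    unfolding h_def by (rule differentiable_cinner[OF \<gamma> \<gamma> V])
  \<comment> \<open>The entries of \<open>h\<close> are differentiated twice; this is where the
    derivative of a frame has to be holomorphic again.\<close>
  have diff_k: "k i j differentiable (at w)" for i j
    unfolding k_def by (rule differentiable_cinner[OF vholomorphic_on_derivative[OF V(1) d] \<gamma> V])
  have diff_L: "L0 differentiable (at w)" "L1 differentiable (at w)"
    unfolding L0_def L1_def
    using differentiable_cinner[OF vholomorphic_on_derivative[OF V(1) d0] s(1) V]
      differentiable_cinner[OF vholomorphic_on_derivative[OF V(1) d1] s(2) V]
      differentiable_cinner[OF s(1) s(1) V] differentiable_cinner[OF s(2) s(2) V] nz V
    by (auto intro!: differentiable_divide)
  \<comment> \<open>The diagonal entries of the connection matrix by Cramer's rule. Their numerators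
    add up to the derivative of the determinant (Jacobi's formula).\<close>
  define \<theta>1 where "\<theta>1 = (\<lambda>z. (h 2 2 z * k 1 1 z - h 1 2 z * k 2 1 z) / D z)"
  define \<theta>2 where "\<theta>2 = (\<lambda>z. (h 1 1 z * k 2 2 z - h 2 1 z * k 1 2 z) / D z)"
  have diff_\<theta>: "\<theta>1 differentiable (at w)" "\<theta>2 differentiable (at w)"
    using D_nz[OF V(2)] unfolding \<theta>1_def \<theta>2_def D_def
    by (intro differentiable_divide differentiable_diff differentiable_mult diff_h diff_k; simp)+
  let ?\<theta> = "\<lambda>z. matrix_inv (gram_matrix \<gamma> z) ** (\<chi> i j. d_w (\<lambda>u. gram_matrix \<gamma> u $ i $ j) z)"
  have \<theta>: "?\<theta> z $ 1 $ 1 = \<theta>1 z" "?\<theta> z $ 2 $ 2 = \<theta>2 z" if z: "z \<in> V" for z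
  proof -
    have g: "gram_matrix \<gamma> u $ i $ j = h i j u" for u i j
      by (simp add: gram_matrix_def h_def)
    have "gram_matrix \<gamma> z $ 1 $ 1 * gram_matrix \<gamma> z $ 2 $ 2 - gram_matrix \<gamma> z $ 1 $ 2 * gram_matrix \<gamma> z $ 2 $ 1 = D z"
      by (simp add: g D_def)
    note inv = matrix_inv_2[OF this D_nz[OF z]]
    show "?\<theta> z $ 1 $ 1 = \<theta>1 z" "?\<theta> z $ 2 $ 2 = \<theta>2 z"
      by (simp_all add: matrix_matrix_mult_def sum_2 inv g dh[OF z] \<theta>1_def \<theta>2_def diff_divide_distrib)
  qed
  \<comment> \<open>The same logarithmic derivative read off from the factorisation of the
    determinant: \<open>C\<close> is constant and \<open>cnj \<Delta>\<close> has derivative 0 in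
    \<open>z\<close>.\<close>
  have sum: "\<theta>1 z + \<theta>2 z = deriv \<Delta> z / \<Delta> z + L0 z + L1 z" if z: "z \<in> V" for z
  proof -
    have \<Delta>': "has_wirtinger \<Delta> (deriv \<Delta> z) 0 z"
      using holomorphic_derivI[OF \<Delta>(1) V(1) z] by (rule has_wirtinger_field_derivative)
    have wh: "has_wirtinger (h i j) (k i j z) (cinner (\<gamma> j z) (\<gamma>' i z)) z" for i j
      unfolding h_def k_def by (rule has_wirtinger_cinner[OF d[OF z] d[OF z]])
    have "d_w D z = k 1 1 z * h 2 2 z + h 1 1 z * k 2 2 z - (k 1 2 z * h 2 1 z + h 1 2 z * k 2 1 z)"
      unfolding D_def by (rule d_w_eq) (rule has_wirtinger_diff has_wirtinger_mult wh)+
    moreover have "d_w D z = D z * (deriv \<Delta> z / \<Delta> z + L0 z + L1 z)"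
    proof -
      let ?E = "\<lambda>z. C * (cinner (s0 z) (s0 z) * cinner (s1 z) (s1 z) * (\<Delta> z * cnj (\<Delta> z)))"
      note E = has_wirtinger_mult[OF has_wirtinger_const[of C] has_wirtinger_mult[OF
            has_wirtinger_mult[OF has_wirtinger_cinner[OF d0[OF z] d0[OF z]] has_wirtinger_cinner[OF d1[OF z] d1[OF z]]]
            has_wirtinger_mult[OF \<Delta>' has_wirtinger_cnj[OF \<Delta>']]]]
      have "d_w D z = d_w ?E z"
        by (rule d_w_cong[OF V(1) z D])
      then show ?thesis
        unfolding d_w_eq[OF E] D[OF z] L0_def L1_def using nz[OF z] \<Delta>(2)[OF z]
        by (simp add: add_divide_eq_iff divide_add_eq_iff) (simp add: algebra_simps)
    qed
    ultimately have "\<theta>1 z + \<theta>2 z = D z * (deriv \<Delta> z / \<Delta> z + L0 z + L1 z) / D z"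
      unfolding \<theta>1_def \<theta>2_def by (simp add: add_divide_distrib[symmetric] algebra_simps)
    then show ?thesis
      using D_nz[OF z] by simp
  qed
  have hol: "has_wirtinger (\<lambda>z. deriv \<Delta> z / \<Delta> z) (deriv (\<lambda>z. deriv \<Delta> z / \<Delta> z) w) 0 w"
    by (intro has_wirtinger_field_derivative holomorphic_derivI[OF _ V] holomorphic_intros \<Delta> V)
  have "trace (frame_curvature \<gamma> w) = - d_wbar (\<lambda>z. ?\<theta> z $ 1 $ 1) w - d_wbar (\<lambda>z. ?\<theta> z $ 2 $ 2) w"
    by (simp add: trace_def sum_2 frame_curvature_def Let_def)
  also have "d_wbar (\<lambda>z. ?\<theta> z $ 1 $ 1) w = d_wbar \<theta>1 w"
    by (rule d_wbar_cong[OF V \<theta>(1)])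
  also have "d_wbar (\<lambda>z. ?\<theta> z $ 2 $ 2) w = d_wbar \<theta>2 w"
    by (rule d_wbar_cong[OF V \<theta>(2)])
  also have "- d_wbar \<theta>1 w - d_wbar \<theta>2 w = - d_wbar (\<lambda>z. \<theta>1 z + \<theta>2 z) w"
    by (simp add: d_wbar_add[OF diff_\<theta>])
  also have "d_wbar (\<lambda>z. \<theta>1 z + \<theta>2 z) w = d_wbar (\<lambda>z. deriv \<Delta> z / \<Delta> z + L0 z + L1 z) w"
    by (rule d_wbar_cong[OF V sum])
  also have "\<dots> = 0 + d_wbar L0 w + d_wbar L1 w"
    using d_wbar_eq[OF has_wirtinger_add[OF has_wirtinger_add[OF hol differentiable_has_wirtinger[OF diff_L(1)]]
          differentiable_has_wirtinger[OF diff_L(2)]]] by simp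
  finally show ?thesis
    using section_curvature_eq[OF d0 V nz(1)] section_curvature_eq[OF d1 V nz(2)]
    by (simp add: L0_def L1_def)
qed


section \<open>Frames of the rank two bundle\<close>

lemma nonvanishing_section_subset:
  "nonvanishing_section A U t \<Longrightarrow> V \<subseteq> U \<Longrightarrow> nonvanishing_section A V t"
  unfolding nonvanishing_section_def by (auto intro: vholomorphic_on_subset)

lemma holomorphic_frame_subset:
  "holomorphic_frame A U \<gamma> \<Longrightarrow> V \<subseteq> U \<Longrightarrow> holomorphic_frame A V \<gamma>"
  unfolding holomorphic_frame_def by (auto intro: vholomorphic_on_subset)

text \<open>Differentiating \<open>(T1 - z) s1 z = 0\<close> shows that \<open>(T1 - z) s1' z = s1 z\<close>; so \<open>- S (s1' z)\<close>
  completes \<open>s1 z\<close> to an eigenvector.\<close>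

lemma FB2_second_section:
  assumes FB: "FB2 \<Omega> T0 S T1" and V: "open V" and s1: "nonvanishing_section T1 V s1"
  obtains \<sigma> where "vholomorphic_on \<sigma> V"
    "\<And>z. z \<in> V \<Longrightarrow> block_op T0 S T1 (\<sigma> z, s1 z) = z *\<^sub>C (\<sigma> z, s1 z)"
proof -
  have T0: "bounded_clinear T0" and T1: "bounded_clinear T1" and S: "bounded_clinear S"
    and ST: "\<And>y. T0 (S y) = S (T1 y)"
    using FB by (auto simp: FB2_def cowen_douglas_def fun_eq_iff)
  have hol: "vholomorphic_on s1 V"
    using s1 by (simp add: nonvanishing_section_def)
  obtain s' where d: "\<And>z. z \<in> V \<Longrightarrow> (s1 has_derivative (\<lambda>h. h *\<^sub>C s' z)) (at z)"
    using vholomorphic_onD[OF hol V] by blast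
  have eig: "T1 (s1 z) = z *\<^sub>C s1 z" if "z \<in> V" for z
    using nonvanishing_sectionD[OF s1 that] by simp
  have T1s': "T1 (s' z) = s1 z + z *\<^sub>C s' z" if z: "z \<in> V" for z
  proof -
    have "((\<lambda>u. u *\<^sub>C s1 u) has_derivative (\<lambda>h. h *\<^sub>C (1 *\<^sub>C s1 z + z *\<^sub>C s' z))) (at z)"
      by (rule has_derivative_scaleC[OF _ d[OF z]]) (rule DERIV_ident)
    moreover have "((\<lambda>u. u *\<^sub>C s1 u) has_derivative (\<lambda>h. h *\<^sub>C T1 (s' z))) (at z)"
      by (rule has_derivative_transform_within_open[OF bounded_clinear_has_derivative[OF T1 d[OF z]] V z eig])
    ultimately have "(\<lambda>h. h *\<^sub>C (1 *\<^sub>C s1 z + z *\<^sub>C s' z)) = (\<lambda>h. h *\<^sub>C T1 (s' z))"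
      by (rule has_derivative_unique)
    from fun_cong[OF this, of 1] show ?thesis
      by (simp add: scaleC_one)
  qed
  have "vholomorphic_on (\<lambda>z. - S (s' z)) V"
    using vholomorphic_on_clinear[OF vholomorphic_on_derivative[OF V d] bounded_clinear_cmult[OF S, of "- 1"]]
    by (simp add: scaleC_one scaleC.minus_left)
  moreover have "block_op T0 S T1 (- S (s' z), s1 z) = z *\<^sub>C (- S (s' z), s1 z)" if "z \<in> V" for z
    unfolding block_op_eigen_iff
    by (simp add: bounded_clinear_simps[OF T0] bounded_clinear_simps[OF S] ST T1s'[OF that] eig[OF that]
        scaleC.minus_right)
  ultimately show thesis
    by (rule that)
qed

text \<open>The second component of \<open>p\<close> is an eigenvector of \<open>T1\<close>, hence
  \<open>d\<close> times \<open>u1\<close>; subtracting \<open>d\<close> times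
  \<open>(x, u1)\<close> leaves an element of \<open>ker (T0 - z)\<close> in the left
  summand.\<close>

lemma FB2_eigenvector_decomposition:
  assumes FB: "FB2 \<Omega> T0 S T1" and z: "z \<in> \<Omega>"
    and s0: "T0 u0 = z *\<^sub>C u0" "u0 \<noteq> 0"
    and s1: "block_op T0 S T1 (x, u1) = z *\<^sub>C (x, u1)" "u1 \<noteq> 0"
    and p: "block_op T0 S T1 p = z *\<^sub>C p"
  obtains c d where "fst p = c *\<^sub>C u0 + d *\<^sub>C x" "snd p = d *\<^sub>C u1"
proof -
  have cd: "cowen_douglas 1 \<Omega> T0" "cowen_douglas 1 \<Omega> T1" and T0: "bounded_clinear T0" and S: "bounded_clinear S"
    using FB by (auto simp: FB2_def cowen_douglas_def)
  have p': "T0 (fst p) + S (snd p) = z *\<^sub>C fst p" "T1 (snd p) = z *\<^sub>C snd p"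
    using p block_op_eigen_iff[of T0 S T1 "fst p" "snd p" z] by auto
  obtain d where d: "snd p = d *\<^sub>C u1"
    using cowen_douglas_1_eigenvector_multiple[OF cd(2) z _ p'(2) s1(2)] s1(1)
    by (auto simp: block_op_eigen_iff)
  have "T0 x = z *\<^sub>C x - S u1" "T0 (fst p) = z *\<^sub>C fst p - d *\<^sub>C S u1"
    using s1(1) p'(1) by (simp_all add: block_op_eigen_iff d bounded_clinear_simps[OF S] eq_diff_eq)
  then have "T0 (fst p - d *\<^sub>C x) = z *\<^sub>C (fst p - d *\<^sub>C x)"
    by (simp add: bounded_clinear_simps[OF T0] scaleC.diff_right complex_vector.scale_left_commute[of z d])
  then obtain c where "fst p - d *\<^sub>C x = c *\<^sub>C u0"
    using cowen_douglas_1_eigenvector_multiple[OF cd(1) z s0(1) _ s0(2)] by blast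
  then have "fst p = c *\<^sub>C u0 + d *\<^sub>C x"
    by (simp add: diff_eq_eq)
  then show thesis
    using d by (rule that)
qed

lemma vholomorphic_on_Pair:
  assumes "vholomorphic_on f V" "vholomorphic_on g V" "open V"
  shows "vholomorphic_on (\<lambda>z. (f z, g z)) V"
proof -
  obtain f' where f: "\<And>z. z \<in> V \<Longrightarrow> (f has_derivative (\<lambda>h. h *\<^sub>C f' z)) (at z)"
    using vholomorphic_onD[OF assms(1,3)] by blast
  obtain g' where g: "\<And>z. z \<in> V \<Longrightarrow> (g has_derivative (\<lambda>h. h *\<^sub>C g' z)) (at z)"
    using vholomorphic_onD[OF assms(2,3)] by blast
  show ?thesis
  proof (rule vholomorphic_onI)
    fix z assume "z \<in> V"
    show "((\<lambda>z. (f z, g z)) has_derivative (\<lambda>h. h *\<^sub>C (f' z, g' z))) (at z)"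
      using has_derivative_Pair[OF f[OF \<open>z \<in> V\<close>] g[OF \<open>z \<in> V\<close>]] by (simp add: scaleC_prod_def)
  qed
qed

lemma FB2_bounded_clinear: "FB2 \<Omega> T0 S T1 \<Longrightarrow> bounded_clinear (block_op T0 S T1)"
  by (auto simp: FB2_def cowen_douglas_def intro: bounded_clinear_block_op)

text \<open>Existence guarantees that the frame chosen in \<open>curvature\<close> really is a
  frame.\<close>

lemma FB2_local_frame:
  assumes FB: "FB2 \<Omega> T0 S T1" and w: "w \<in> \<Omega>"
  obtains U \<gamma> where "open U" "w \<in> U" "U \<subseteq> \<Omega>"
    "holomorphic_frame (block_op T0 S T1) U (\<gamma> :: 2 \<Rightarrow> _)"
proof -
  have cd: "cowen_douglas 1 \<Omega> T0" "cowen_douglas 1 \<Omega> T1" and lin: "bounded_clinear S" "bounded_clinear T1"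
    using FB by (auto simp: FB2_def cowen_douglas_def)
  obtain s0 r0 where s0: "r0 > 0" "ball w r0 \<subseteq> \<Omega>" "nonvanishing_section T0 (ball w r0) s0"
    using cowen_douglas_1_local_section[OF cd(1) w] by blast
  obtain s1 r1 where s1: "r1 > 0" "ball w r1 \<subseteq> \<Omega>" "nonvanishing_section T1 (ball w r1) s1"
    using cowen_douglas_1_local_section[OF cd(2) w] by blast
  define U where "U = ball w r0 \<inter> ball w r1"
  have U: "open U" "w \<in> U" "U \<subseteq> \<Omega>"
    using s0 s1 by (auto simp: U_def)
  have sec: "nonvanishing_section T0 U s0" "nonvanishing_section T1 U s1"
    using s0(3) s1(3) by (auto simp: U_def intro: nonvanishing_section_subset)
  note e0 = nonvanishing_sectionD[OF sec(1)] and e1 = nonvanishing_sectionD[OF sec(2)]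
  obtain \<sigma> where \<sigma>: "vholomorphic_on \<sigma> U"
      "\<And>z. z \<in> U \<Longrightarrow> block_op T0 S T1 (\<sigma> z, s1 z) = z *\<^sub>C (\<sigma> z, s1 z)"
    using FB2_second_section[OF FB U(1) sec(2)] by blast
  define \<gamma> :: "2 \<Rightarrow> complex \<Rightarrow> 'a \<times> 'b" where
    "\<gamma> = (\<lambda>i z. if i = 1 then (s0 z, 0) else (\<sigma> z, s1 z))"
  have "holomorphic_frame (block_op T0 S T1) U \<gamma>"
    unfolding holomorphic_frame_def
  proof (intro conjI allI ballI)
    have "vholomorphic_on (\<lambda>z. 0 :: 'b) U"
      unfolding vholomorphic_on_def
      by (intro ballI exI[of _ 0]) simp
    then have "vholomorphic_on (\<lambda>z. (s0 z, 0 :: 'b)) U" "vholomorphic_on (\<lambda>z. (\<sigma> z, s1 z)) U"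
      using vholomorphic_on_Pair[OF _ _ U(1)] sec \<sigma>(1) by (auto simp: nonvanishing_section_def)
    then show "vholomorphic_on (\<gamma> i) U" for i
      by (cases "i = 1") (simp_all add: \<gamma>_def)
    fix z assume z: "z \<in> U"
    have range: "range (\<lambda>i. \<gamma> i z) = {(\<sigma> z, s1 z), (s0 z, 0)}"
      by (auto simp: \<gamma>_def UNIV_2)
    show "inj (\<lambda>i. \<gamma> i z)"
      using e1(2)[OF z] by (auto simp: inj_def \<gamma>_def forall_2)
    have "(\<sigma> z, s1 z) \<notin> complex_vector.span {(s0 z, 0)}"
      using e1(2)[OF z] by (auto simp: complex_vector.span_singleton scaleC_prod_def)
    then show "complex_vector.independent (range (\<lambda>i. \<gamma> i z))"
      unfolding range using e0(2)[OF z] e1(2)[OF z]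
      by (simp add: complex_vector.independent_insert zero_prod_def)
    have mem: "(\<sigma> z, s1 z) \<in> op_kernel (op_minus (block_op T0 S T1) z)"
        "(s0 z, 0) \<in> op_kernel (op_minus (block_op T0 S T1) z)"
      unfolding mem_op_kernel_op_minus using \<sigma>(2)[OF z] e0(1)[OF z]
      by (simp_all add: block_op_eigen_iff bounded_clinear_zero[OF lin(1)] bounded_clinear_zero[OF lin(2)])
    show "complex_vector.span (range (\<lambda>i. \<gamma> i z)) = op_kernel (op_minus (block_op T0 S T1) z)"
      unfolding range
    proof
      show "complex_vector.span {(\<sigma> z, s1 z), (s0 z, 0)} \<subseteq> op_kernel (op_minus (block_op T0 S T1) z)"
        using mem by (intro complex_vector.span_minimal subspace_op_kernel bounded_clinear_op_minus
            FB2_bounded_clinear[OF FB]) auto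
      show "op_kernel (op_minus (block_op T0 S T1) z) \<subseteq> complex_vector.span {(\<sigma> z, s1 z), (s0 z, 0)}"
      proof
        fix p assume "p \<in> op_kernel (op_minus (block_op T0 S T1) z)"
        then have p: "block_op T0 S T1 p = z *\<^sub>C p"
          by (simp add: mem_op_kernel_op_minus)
        obtain c d where "fst p = c *\<^sub>C s0 z + d *\<^sub>C \<sigma> z" "snd p = d *\<^sub>C s1 z"
          using FB2_eigenvector_decomposition[OF FB _ e0[OF z] \<sigma>(2)[OF z] e1(2)[OF z] p] z U(3) by blast
        then have "p = c *\<^sub>C (s0 z, 0) + d *\<^sub>C (\<sigma> z, s1 z)"
          by (simp add: prod_eq_iff scaleC_prod_def)
        then show "p \<in> complex_vector.span {(\<sigma> z, s1 z), (s0 z, 0)}"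
          by (simp add: complex_vector.span_add complex_vector.span_scale complex_vector.span_base)
      qed
    qed
  qed
  then show thesis
    using U that by blast
qed

text \<open>The arbitrary frame is expanded in \<open>(s0, 0)\<close> and
  \<open>(\<sigma>, s1)\<close>. The coefficients are holomorphic near \<open>w\<close>, and
  \<open>\<Delta>\<close> is their determinant.\<close>

lemma FB2_trace_frame_curvature:
  fixes T0 :: "'a::{chilbert_space,second_countable_topology} \<Rightarrow> 'a"
    and T1 :: "'b::{chilbert_space,second_countable_topology} \<Rightarrow> 'b"
    and \<gamma> :: "2 \<Rightarrow> complex \<Rightarrow> 'a \<times> 'b"
  assumes FB: "FB2 \<Omega> T0 S T1" and W: "open W" "w \<in> W" "W \<subseteq> \<Omega>"
    and frame: "holomorphic_frame (block_op T0 S T1) W \<gamma>"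
    and s0: "nonvanishing_section T0 W s0" and s1: "nonvanishing_section T1 W s1"
    and slope: "\<And>z. z \<in> W \<Longrightarrow> kernel_slope T0 (block_op T0 S T1) z q" and "q \<ge> 0"
  shows "trace (frame_curvature \<gamma> w) = section_curvature s0 w + section_curvature s1 w"
proof -
  note e0 = nonvanishing_sectionD[OF s0] and e1 = nonvanishing_sectionD[OF s1]
  obtain \<sigma> where \<sigma>: "vholomorphic_on \<sigma> W"
      "\<And>z. z \<in> W \<Longrightarrow> block_op T0 S T1 (\<sigma> z, s1 z) = z *\<^sub>C (\<sigma> z, s1 z)"
    using FB2_second_section[OF FB W(1) s1] by blast
  have hol0: "vholomorphic_on s0 W" and hol1: "vholomorphic_on s1 W"
    using s0 s1 by (auto simp: nonvanishing_section_def)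
  have hol\<gamma>: "vholomorphic_on (\<gamma> i) W" for i
    using frame by (simp add: holomorphic_frame_def)
  \<comment> \<open>Pairing with the fixed vectors \<open>s0 w\<close> and \<open>s1 w\<close>
    recovers the coefficients as quotients of holomorphic functions. The denominators are non-zero
    at \<open>w\<close> and therefore on a neighbourhood \<open>V\<close>.\<close>
  define a0 where "a0 = (\<lambda>z. cinner (s0 z) (s0 w))"
  define a1 where "a1 = (\<lambda>z. cinner (s1 z) (s1 w))"
  define V where "V = (W \<inter> a0 -` (- {0})) \<inter> (W \<inter> a1 -` (- {0}))"
  have hol_a: "a0 holomorphic_on W" "a1 holomorphic_on W"
    unfolding a0_def a1_def by (rule vholomorphic_on_cinner[OF hol0] vholomorphic_on_cinner[OF hol1])+
  have "open V"
    unfolding V_def using W(1) holomorphic_on_imp_continuous_on[OF hol_a(1)] holomorphic_on_imp_continuous_on[OF hol_a(2)]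
    by (intro open_Int continuous_open_preimage open_Compl closed_singleton)
  have "w \<in> V"
    using W(2) e0(2) e1(2) by (simp add: V_def a0_def a1_def)
  have "V \<subseteq> W"
    by (auto simp: V_def)
  define f2 where "f2 = (\<lambda>i z. cinner (snd (\<gamma> i z)) (s1 w) / a1 z)"
  define f1 where "f1 = (\<lambda>i z. (cinner (fst (\<gamma> i z)) (s0 w) - f2 i z * cinner (\<sigma> z) (s0 w)) / a0 z)"
  have hol_f2: "f2 i holomorphic_on V" for i
    unfolding f2_def using \<open>V \<subseteq> W\<close>
    by (intro holomorphic_on_divide holomorphic_on_subset[OF hol_a(2)]
        holomorphic_on_subset[OF vholomorphic_on_cinner[OF vholomorphic_on_clinear[OF hol\<gamma> bounded_clinear_snd]]])
      (auto simp: V_def)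
  have hol_f1: "f1 i holomorphic_on V" for i
    unfolding f1_def using \<open>V \<subseteq> W\<close>
    by (intro holomorphic_on_divide holomorphic_on_diff holomorphic_on_mult hol_f2
        holomorphic_on_subset[OF hol_a(1)] holomorphic_on_subset[OF vholomorphic_on_cinner[OF \<sigma>(1)]]
        holomorphic_on_subset[OF vholomorphic_on_cinner[OF vholomorphic_on_clinear[OF hol\<gamma> bounded_clinear_fst]]])
      (auto simp: V_def)
  have \<gamma>: "fst (\<gamma> i z) = f1 i z *\<^sub>C s0 z + f2 i z *\<^sub>C \<sigma> z" "snd (\<gamma> i z) = f2 i z *\<^sub>C s1 z" if z: "z \<in> V" for i z
  proof -
    have zW: "z \<in> W" and nz: "a0 z \<noteq> 0" "a1 z \<noteq> 0"
      using z by (auto simp: V_def)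
    have "\<gamma> i z \<in> op_kernel (op_minus (block_op T0 S T1) z)"
    proof -
      have "\<gamma> i z \<in> complex_vector.span (range (\<lambda>i. \<gamma> i z))"
        by (intro complex_vector.span_base rangeI)
      then show ?thesis
        using frame zW by (simp add: holomorphic_frame_def)
    qed
    then have "block_op T0 S T1 (\<gamma> i z) = z *\<^sub>C \<gamma> i z"
      by (simp add: mem_op_kernel_op_minus)
    then obtain c d where cd: "fst (\<gamma> i z) = c *\<^sub>C s0 z + d *\<^sub>C \<sigma> z" "snd (\<gamma> i z) = d *\<^sub>C s1 z"
      using FB2_eigenvector_decomposition[OF FB subsetD[OF W(3) zW] e0[OF zW] \<sigma>(2)[OF zW] e1(2)[OF zW]]
      by blast
    have "f2 i z = d"
      using nz by (simp add: f2_def cd cinner_scaleC_left a1_def)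
    moreover from this have "f1 i z = c"
      using nz by (simp add: f1_def cd cinner_scaleC_left cinner_add_left a0_def)
    ultimately show "fst (\<gamma> i z) = f1 i z *\<^sub>C s0 z + f2 i z *\<^sub>C \<sigma> z" "snd (\<gamma> i z) = f2 i z *\<^sub>C s1 z"
      using cd by simp_all
  qed
  define \<Delta> where "\<Delta> = (\<lambda>z. f1 1 z * f2 2 z - f1 2 z * f2 1 z)"
  have \<gamma>_comb: "a *\<^sub>C \<gamma> 1 z + b *\<^sub>C \<gamma> 2 z = 0"
    if "z \<in> V" "a * f1 1 z + b * f1 2 z = 0" "a * f2 1 z + b * f2 2 z = 0" for a b z
  proof (rule prod_eqI)
    have "fst (a *\<^sub>C \<gamma> 1 z + b *\<^sub>C \<gamma> 2 z)
        = (a * f1 1 z + b * f1 2 z) *\<^sub>C s0 z + (a * f2 1 z + b * f2 2 z) *\<^sub>C \<sigma> z"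
      by (simp add: scaleC_prod_def \<gamma>[OF that(1)] scaleC_add_right scaleC_add_left scaleC_scaleC)
    then show "fst (a *\<^sub>C \<gamma> 1 z + b *\<^sub>C \<gamma> 2 z) = fst 0"
      by (simp add: that)
    have "snd (a *\<^sub>C \<gamma> 1 z + b *\<^sub>C \<gamma> 2 z) = (a * f2 1 z + b * f2 2 z) *\<^sub>C s1 z"
      by (simp add: scaleC_prod_def \<gamma>[OF that(1)] scaleC_add_left scaleC_scaleC)
    then show "snd (a *\<^sub>C \<gamma> 1 z + b *\<^sub>C \<gamma> 2 z) = snd 0"
      by (simp add: that)
  qed
  have \<Delta>_nz: "\<Delta> z \<noteq> 0" if z: "z \<in> V" for z
  proof
    assume 0: "\<Delta> z = 0"
    have "inj (\<lambda>i. \<gamma> i z)" and ind: "complex_vector.independent (range (\<lambda>i. \<gamma> i z))"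
      using frame z \<open>V \<subseteq> W\<close> by (auto simp: holomorphic_frame_def)
    then have neq: "\<gamma> 1 z \<noteq> \<gamma> 2 z"
      by (auto simp: inj_def forall_2)
    have "range (\<lambda>i. \<gamma> i z) = {\<gamma> 1 z, \<gamma> 2 z}"
      by (auto simp: UNIV_2)
    then have ind': "\<gamma> 2 z \<noteq> 0" "\<And>c. \<gamma> 1 z \<noteq> c *\<^sub>C \<gamma> 2 z"
      using ind neq by (auto simp: complex_vector.independent_insert complex_vector.span_singleton)
    have zero: "a = 0 \<and> b = 0" if "a * f1 1 z + b * f1 2 z = 0" "a * f2 1 z + b * f2 2 z = 0" for a b
    proof -
      have *: "a *\<^sub>C \<gamma> 1 z + b *\<^sub>C \<gamma> 2 z = 0"
        by (rule \<gamma>_comb[OF z that])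
      have "a = 0"
      proof (rule ccontr)
        assume "a \<noteq> 0"
        have "a *\<^sub>C \<gamma> 1 z = (- b) *\<^sub>C \<gamma> 2 z"
          using * by (simp add: scaleC.minus_left eq_neg_iff_add_eq_0)
        then have "(1 / a) *\<^sub>C a *\<^sub>C \<gamma> 1 z = (1 / a) *\<^sub>C (- b) *\<^sub>C \<gamma> 2 z"
          by simp
        then have "\<gamma> 1 z = (1 / a * - b) *\<^sub>C \<gamma> 2 z"
          using \<open>a \<noteq> 0\<close> by (simp only: scaleC_scaleC) (simp add: scaleC_one)
        then show False
          using ind'(2) by blast
      qed
      then show ?thesis
        using * ind'(1) by simp
    qed
    \<comment> \<open>When \<Delta> vanishes, both cofactor vectors solve the system in
      \<open>zero\<close>, so all coefficients are 0 at \<open>z\<close>; but then the pair 1, 0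
      solves it as well.\<close>
    have "f2 2 z = 0 \<and> - f2 1 z = 0" "f1 2 z = 0 \<and> - f1 1 z = 0"
      by (rule zero; use 0 in \<open>simp add: \<Delta>_def algebra_simps\<close>)+
    then show False
      using zero[of 1 0] by simp
  qed
  have hol_\<Delta>: "\<Delta> holomorphic_on V"
    unfolding \<Delta>_def by (intro holomorphic_intros hol_f1 hol_f2)
  show ?thesis
  proof (rule trace_frame_curvature[OF \<open>open V\<close> \<open>w \<in> V\<close>])
    show "vholomorphic_on (\<gamma> i) V" for i
      using hol\<gamma> \<open>V \<subseteq> W\<close> by (rule vholomorphic_on_subset)
    show "vholomorphic_on s0 V" "vholomorphic_on s1 V"
      using hol0 hol1 \<open>V \<subseteq> W\<close> by (auto intro: vholomorphic_on_subset)
    show "z \<in> V \<Longrightarrow> s0 z \<noteq> 0" "z \<in> V \<Longrightarrow> s1 z \<noteq> 0" for z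
      using e0(2) e1(2) \<open>V \<subseteq> W\<close> by auto
    show "\<Delta> holomorphic_on V" "z \<in> V \<Longrightarrow> \<Delta> z \<noteq> 0" for z
      by (rule hol_\<Delta>, rule \<Delta>_nz)
    show "complex_of_real (1 + q) \<noteq> 0"
      using \<open>q \<ge> 0\<close> unfolding of_real_eq_0_iff by simp
    fix z assume z: "z \<in> V"
    have zW: "z \<in> W"
      using z \<open>V \<subseteq> W\<close> by blast
    have lin: "bounded_clinear T0" "bounded_clinear S"
      using FB by (auto simp: FB2_def cowen_douglas_def)
    have cd: "cowen_douglas 1 \<Omega> T0"
      using FB by (simp add: FB2_def)
    \<comment> \<open>\<open>x\<close> is the component of \<open>\<sigma> z\<close> orthogonal to
      \<open>s0 z\<close>, the one whose length the slope determines.\<close>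
    define \<alpha> where "\<alpha> = cinner (\<sigma> z) (s0 z) / cinner (s0 z) (s0 z)"
    define x where "x = \<sigma> z - \<alpha> *\<^sub>C s0 z"
    have perp: "cinner x (s0 z) = 0"
      using e0(2)[OF zW] by (simp add: x_def \<alpha>_def cinner.diff_left cinner_scaleC_left)
    then have perp': "cinner (s0 z) x = 0"
      by (metis cinner_commute complex_cnj_zero)
    have "(norm x)\<^sup>2 = q * (norm (s1 z))\<^sup>2"
    proof (rule kernel_slope_eq[OF FB _ slope[OF zW]])
      show "z \<in> \<Omega>"
        using zW W(3) by blast
      show "block_op T0 S T1 (x, s1 z) = z *\<^sub>C (x, s1 z)"
        using \<sigma>(2)[OF zW] e0(1)[OF zW]
        by (simp add: block_op_eigen_iff x_def bounded_clinear_simps[OF lin(1)] scaleC.diff_right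
            complex_vector.scale_left_commute[of z \<alpha>] algebra_simps)
      show "cinner x k = 0" if k: "T0 k = z *\<^sub>C k" for k
      proof -
        obtain c where "k = c *\<^sub>C s0 z"
          using cowen_douglas_1_eigenvector_multiple[OF cd \<open>z \<in> \<Omega>\<close> e0(1)[OF zW] k e0(2)[OF zW]] by blast
        then show ?thesis
          by (simp add: cinner_scaleC_right perp)
      qed
    qed
    then have xx: "cinner x x = of_real q * cinner (s1 z) (s1 z)"
      unfolding cinner_self by simp
    define g where "g = (\<lambda>i. f1 i z + f2 i z * \<alpha>)"
    have fst: "fst (\<gamma> i z) = g i *\<^sub>C s0 z + f2 i z *\<^sub>C x" for i
      by (simp add: \<gamma>[OF z] g_def x_def scaleC_add_left scaleC.diff_right scaleC_scaleC)
    have gram: "cinner (\<gamma> j z) (\<gamma> i z) = g j * cnj (g i) * cinner (s0 z) (s0 z)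
        + f2 j z * cnj (f2 i z) * (1 + of_real q) * cinner (s1 z) (s1 z)" for i j
      by (simp add: cinner_prod_def fst \<gamma>(2)[OF z] cinner_add_left cinner_add_right cinner_scaleC_left
          cinner_scaleC_right perp perp' xx algebra_simps)
    \<comment> \<open>Passing from \<open>\<sigma> z\<close> to \<open>x\<close> is a unipotent
      change of frame and leaves the determinant unchanged.\<close>
    have \<Delta>: "\<Delta> z = g 1 * f2 2 z - g 2 * f2 1 z"
      by (simp add: \<Delta>_def g_def algebra_simps)
    show "cinner (\<gamma> 1 z) (\<gamma> 1 z) * cinner (\<gamma> 2 z) (\<gamma> 2 z) - cinner (\<gamma> 2 z) (\<gamma> 1 z) * cinner (\<gamma> 1 z) (\<gamma> 2 z)
      = complex_of_real (1 + q) * (cinner (s0 z) (s0 z) * cinner (s1 z) (s1 z) * (\<Delta> z * cnj (\<Delta> z)))"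
      unfolding gram \<Delta> by (simp add: algebra_simps)
  qed
qed

theorem proposition1p6:
  fixes T0 :: "'a::{chilbert_space,second_countable_topology} \<Rightarrow> 'a"
    and T1 :: "'b::{chilbert_space,second_countable_topology} \<Rightarrow> 'b"
    and S :: "'b \<Rightarrow> 'a"
    and T :: "'a \<times> 'b \<Rightarrow> 'a \<times> 'b"
  assumes "T = block_op T0 S T1"
    and "FB2 (ball 0 1) T0 S T1"
    and "homogeneous T"
  shows "\<forall>w\<in>ball 0 1.
    trace (curvature (ball 0 1) T w :: complex^2^2) =
      line_curvature (ball 0 1) T0 w + line_curvature (ball 0 1) T1 w"
proof
  fix w :: complex assume w: "w \<in> ball 0 1"
  let ?D = "ball 0 1 :: complex set"
  note FB = assms(2)
  have cd: "cowen_douglas 1 ?D T0" "cowen_douglas 1 ?D T1"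
    using FB by (auto simp: FB2_def)
  let ?\<gamma> = "SOME \<gamma> :: 2 \<Rightarrow> complex \<Rightarrow> 'a \<times> 'b. \<exists>U. open U \<and> w \<in> U \<and> U \<subseteq> ?D \<and> holomorphic_frame T U \<gamma>"
  let ?s0 = "SOME \<gamma>. \<exists>U. open U \<and> w \<in> U \<and> U \<subseteq> ?D \<and> nonvanishing_section T0 U \<gamma>"
  let ?s1 = "SOME \<gamma>. \<exists>U. open U \<and> w \<in> U \<and> U \<subseteq> ?D \<and> nonvanishing_section T1 U \<gamma>"
  have "\<exists>\<gamma> :: 2 \<Rightarrow> complex \<Rightarrow> 'a \<times> 'b. \<exists>U. open U \<and> w \<in> U \<and> U \<subseteq> ?D \<and> holomorphic_frame T U \<gamma>"
    unfolding assms(1) using FB2_local_frame[OF FB w] by metis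
  from someI_ex[OF this] obtain U where U: "open U" "w \<in> U" "U \<subseteq> ?D" "holomorphic_frame T U ?\<gamma>"
    by blast
  have "\<exists>s U. open U \<and> w \<in> U \<and> U \<subseteq> ?D \<and> nonvanishing_section T0 U s"
    using cowen_douglas_1_local_section[OF cd(1) w] by (metis centre_in_ball open_ball)
  from someI_ex[OF this] obtain U0 where U0: "open U0" "w \<in> U0" "nonvanishing_section T0 U0 ?s0"
    by blast
  have "\<exists>s U. open U \<and> w \<in> U \<and> U \<subseteq> ?D \<and> nonvanishing_section T1 U s"
    using cowen_douglas_1_local_section[OF cd(2) w] by (metis centre_in_ball open_ball)
  from someI_ex[OF this] obtain U1 where U1: "open U1" "w \<in> U1" "nonvanishing_section T1 U1 ?s1"
    by blast
  obtain q where q: "q \<ge> 0" "kernel_slope T0 T w q"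
    unfolding assms(1) using kernel_slope_exists[OF FB w] by blast
  obtain r where r: "r > 0" "\<And>z. z \<in> ball w r \<Longrightarrow> kernel_slope T0 T z q"
    using kernel_slope_locally_constant[OF FB _ w] assms(3) q(2) unfolding assms(1) by metis
  \<comment> \<open>The chosen frame and the two chosen sections come with separate domains, and the
    slope is known to be constant only near \<open>w\<close>.\<close>
  let ?W = "U \<inter> U0 \<inter> U1 \<inter> ball w r"
  have "trace (frame_curvature ?\<gamma> w) = section_curvature ?s0 w + section_curvature ?s1 w"
  proof (rule FB2_trace_frame_curvature[OF FB, of ?W])
    show "open ?W" "w \<in> ?W" "?W \<subseteq> ?D"
      using U U0 U1 r(1) by auto
    show "holomorphic_frame (block_op T0 S T1) ?W ?\<gamma>"
      using U(4) unfolding assms(1) by (rule holomorphic_frame_subset) blast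
    show "nonvanishing_section T0 ?W ?s0"
      using U0(3) by (rule nonvanishing_section_subset) blast
    show "nonvanishing_section T1 ?W ?s1"
      using U1(3) by (rule nonvanishing_section_subset) blast
    show "z \<in> ?W \<Longrightarrow> kernel_slope T0 (block_op T0 S T1) z q" for z
      using r(2) unfolding assms(1) by blast
  qed (rule q(1))
  then show "trace (curvature ?D T w :: complex^2^2) = line_curvature ?D T0 w + line_curvature ?D T1 w"
    unfolding curvature_def line_curvature_def .
qed

end
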